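(* Let $\boldsymbol F=(f_1,\ldots,f_m)$ be a sequence of nonzero polynomials in $R=K[x_1,\ldots,x_n]$, and let $$d_{\rm inj}:=\inf\{d\in\mathbb Z_{\ge1}\mid (R'/\langle F^h\rangle)_{d-1}\xrightarrow{\times y}(R'/\langle F^h\rangle)_d\text{ is not injective}\},\qquad \inf\emptyset=\infty.$$ If $d_{\rm inj}<\infty$, then the first degree fall in the Buchberger-like computation (with the normal selection strategy) for $\langle F\rangle$ occurs at step degree $d_{\rm inj}$. If $d_{\rm inj}=\infty$, no degree fall occurs. Equivalently, for every positive integer $d_0$, the injectivity condition below $d_0$ holds if and only if no degree fall occurs at any step degree less than $d_0$ in the affine computation (the computation for $\langle F\rangle$).
   Context: **Notation.** $K$ is a field, $R=K[x_1,\ldots,x_n]$, $R'=R[y]$. $\prec$ is a fixed degree reverse lexicographic (DRL) ordering on $R$; $\prec^h$ is its homogenization on $R'$, i.e. the DRL ordering on $R'$ restricting to $\prec$ on $R$ with $y$ the smallest variable. $F=\{f_1,\ldots,f_m\}$, $f_i^h\in R'$ is the homogenization of $f_i$ with respect to $y$, $F^h=\{f_1^h,\ldots,f_m^h\}$. **Buchberger-like computation.** In $A=R$ (ordering $\prec$, input $F$) or $A=R'$ (ordering $\prec^h$, input $F^h$), a computation maintains a current (intermediate) basis, initially the input generators (distinguished by indices), and a collection of available S-pairs, initially all pairs of input generators. At each stage a single available S-pair $(g_1,g_2)$ is selected, and $S(g_1,g_2)=\sum_{i=1,2}(-1)^{i-1}\frac{\operatorname{lcm}(\operatorname{LM}(g_1),\operatorname{LM}(g_2))}{\operatorname{LT}(g_i)}g_i$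 is formed and reduced by the current basis to a remainder (a polynomial no term of which is divisible by a leading monomial of the current basis); a nonzero remainder is inserted into the current basis and all new S-pairs involving it are generated. Unnecessary S-pairs may be discarded by criteria depending only on leading monomials; in particular Buchberger's product criterion is applied (pairs with relatively prime leading monomials are discarded without being processed). The degree of an S-pair is $\deg\operatorname{lcm}(\operatorname{LM}(g_1),\operatorname{LM}(g_2))$. The normal selection strategy selects an available S-pair whose lcm is minimal in the monomial ordering; ties and the order of reducers are arbitrary. The step degree is the degree of the selected S-pair. **Degree fall.** A degree fall occurs at step degree $d$ if a nonzero remainder obtained at step degree $d$ has total degree strictly smaller than $d$. "First" refers to the order of the computation. **Injectivity condition below $d_0$.** Let $\mathcal B$ be the minimal monomial generating set of $\langle\operatorname{LM}_{\prec^h}(\langle F^h\rangle)\rangle$. The condition requires that for every positive integer $d<d_0$ all of the following hold: (A) multiplication by $y$, $(R'/\langle F^h\rangle)_{d-1}\to(R'/\langle F^h\rangle)_d$, is injective; (B) no monomial of degree $d$ in $\mathcal B$ is divisible by $y$; (C) in a Buchberger-like computation with the normal selection strategy for $\langle F^h\rangle$, every nonzero remainder obtained at step degree $d$ has leading monomial not divisible by $y$.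
   Formalization: In the final equivalence, "no degree fall at any step degree less than d_0" counts only steps before the affine computation first reaches step degree at least d_0; over the whole computation it fails, e.g. F=(x^5, x^5+x^2, xz+1), d_0=4. *)

theory Defs
  imports "HOL-Library.Poly_Mapping" "HOL-Library.Option_ord" "HOL-Library.Extended_Nat"
begin

section \<open>Monomials and polynomials\<close>

text \<open>
  A monomial is its exponent vector, so multiplication of monomials is addition of exponents.
  For a finite type \<open>'x\<close> of variables, \<open>('x, 'k) pol\<close> is the polynomial ring \<open>R\<close>, and
  \<open>('x option, 'k) pol\<close> is \<open>R' = R[y]\<close>, with \<open>None\<close> in the role of \<open>y\<close>.
\<close>

type_synonym 'v mon = "'v \<Rightarrow>\<^sub>0 nat"
type_synonym ('v, 'k) pol = "'v mon \<Rightarrow>\<^sub>0 'k"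

abbreviation monom :: "'v mon \<Rightarrow> 'k::zero \<Rightarrow> ('v, 'k) pol" where
  "monom t c \<equiv> Poly_Mapping.single t c"

definition mdeg :: "'v mon \<Rightarrow> nat" where
  "mdeg t = (\<Sum>v\<in>Poly_Mapping.keys t. Poly_Mapping.lookup t v)"

definition mdvd :: "'v mon \<Rightarrow> 'v mon \<Rightarrow> bool" where
  "mdvd s t \<longleftrightarrow> (\<forall>v. Poly_Mapping.lookup s v \<le> Poly_Mapping.lookup t v)"

text \<open>Subtraction of exponents truncates, so this is the pointwise maximum.\<close>

definition mlcm :: "'v mon \<Rightarrow> 'v mon \<Rightarrow> 'v mon" where
  "mlcm s t = s + (t - s)"

definition mcoprime :: "'v mon \<Rightarrow> 'v mon \<Rightarrow> bool" where
  "mcoprime s t \<longleftrightarrow> Poly_Mapping.keys s \<inter> Poly_Mapping.keys t = {}"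

text \<open>
  The degree reverse lexicographic ordering, where \<open>v < w\<close> in the type of variables means that
  \<open>v\<close> is the smaller variable. Ties in the degree are decided at the smallest variable whose
  exponents differ. On \<open>'x option\<close> we have \<open>None < Some x\<close>, so there this is the DRL ordering
  that extends the one on \<open>'x\<close> and has \<open>y\<close> as its smallest variable.
\<close>

definition drl_less :: "'v::linorder mon \<Rightarrow> 'v mon \<Rightarrow> bool" where
  "drl_less s t \<longleftrightarrow> mdeg s < mdeg t \<or>
     (mdeg s = mdeg t \<and> (\<exists>v. Poly_Mapping.lookup s v > Poly_Mapping.lookup t v \<and>
        (\<forall>w<v. Poly_Mapping.lookup s w = Poly_Mapping.lookup t w)))"

definition tdeg :: "('v, 'k::zero) pol \<Rightarrow> nat" where
  "tdeg p = Max (insert 0 (mdeg ` Poly_Mapping.keys p))"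

definition homogeneous :: "nat \<Rightarrow> ('v, 'k::zero) pol \<Rightarrow> bool" where
  "homogeneous d p \<longleftrightarrow> (\<forall>t\<in>Poly_Mapping.keys p. mdeg t = d)"

text \<open>Leading monomial and coefficient; only meaningful for nonzero polynomials.\<close>

definition LM :: "('v::linorder, 'k::zero) pol \<Rightarrow> 'v mon" where
  "LM p = (THE t. t \<in> Poly_Mapping.keys p \<and> (\<forall>s\<in>Poly_Mapping.keys p - {t}. drl_less s t))"

definition LC :: "('v::linorder, 'k::zero) pol \<Rightarrow> 'k" where
  "LC p = Poly_Mapping.lookup p (LM p)"

abbreviation ideal_of :: "'a::comm_ring_1 set \<Rightarrow> 'a set" where
  "ideal_of \<equiv> module.span (*)"

section \<open>Homogenization\<close>

definition lift_mon :: "'x mon \<Rightarrow> 'x option mon" where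
  "lift_mon t = (\<Sum>v\<in>Poly_Mapping.keys t. Poly_Mapping.single (Some v) (Poly_Mapping.lookup t v))"

definition ymon :: "'x option mon" where
  "ymon = Poly_Mapping.single None 1"

definition homogenize :: "('x, 'k::comm_ring_1) pol \<Rightarrow> ('x option, 'k) pol" where
  "homogenize f = (\<Sum>t\<in>Poly_Mapping.keys f.
     monom (lift_mon t + Poly_Mapping.single None (tdeg f - mdeg t)) (Poly_Mapping.lookup f t))"

abbreviation hom_ideal :: "('x, 'k::comm_ring_1) pol list \<Rightarrow> ('x option, 'k) pol set" where
  "hom_ideal F \<equiv> ideal_of (homogenize ` set F)"

section \<open>Buchberger-like computations\<close>

definition spoly :: "('v::linorder, 'k::field) pol \<Rightarrow> ('v, 'k) pol \<Rightarrow> ('v, 'k) pol" where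
  "spoly g1 g2 = (let l = mlcm (LM g1) (LM g2) in
     monom (l - LM g1) (1 / LC g1) * g1 - monom (l - LM g2) (1 / LC g2) * g2)"

definition red_step :: "('v::linorder, 'k::field) pol set \<Rightarrow> ('v, 'k) pol \<Rightarrow> ('v, 'k) pol \<Rightarrow> bool" where
  "red_step G p q \<longleftrightarrow> (\<exists>g\<in>G. \<exists>t\<in>Poly_Mapping.keys p. mdvd (LM g) t \<and>
     q = p - monom (t - LM g) (Poly_Mapping.lookup p t / LC g) * g)"

definition remainder :: "('v::linorder, 'k::field) pol set \<Rightarrow> ('v, 'k) pol \<Rightarrow> ('v, 'k) pol \<Rightarrow> bool" where
  "remainder G p r \<longleftrightarrow> (red_step G)\<^sup>*\<^sup>* p r \<and> (\<forall>t\<in>Poly_Mapping.keys r. \<forall>g\<in>G. \<not> mdvd (LM g) t)"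

text \<open>S-pairs are pairs \<open>(i, j)\<close>, \<open>i < j\<close>, of indices into the list of current basis elements.\<close>

abbreviation pair_lcm :: "('v::linorder, 'k::zero) pol list \<Rightarrow> nat \<times> nat \<Rightarrow> 'v mon" where
  "pair_lcm G p \<equiv> mlcm (LM (G ! fst p)) (LM (G ! snd p))"

abbreviation pair_coprime :: "('v::linorder, 'k::zero) pol list \<Rightarrow> nat \<times> nat \<Rightarrow> bool" where
  "pair_coprime G p \<equiv> mcoprime (LM (G ! fst p)) (LM (G ! snd p))"

text \<open>
  Which pairs may be discarded, judged by leading monomials only, besides those with coprime
  leading monomials. \<open>T\<close> is the set of pairs that are available or have been processed. The pair
  \<open>(i, j)\<close> is unnecessary if \<open>i\<close> and \<open>j\<close> are linked by a chain of other pairs, each in \<open>T\<close> or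
  coprime, through basis elements whose leading monomials divide the lcm of the pair. This says
  that the syzygy of leading terms belonging to \<open>(i, j)\<close> is in the span of those belonging to
  these other pairs; a chain of length two is the classical chain criterion, and the
  Gebauer-Moeller criteria are instances too.
\<close>

definition unnecessary :: "('v::linorder, 'k::zero) pol list \<Rightarrow> (nat \<times> nat) set \<Rightarrow> nat \<times> nat \<Rightarrow> bool" where
  "unnecessary G T p \<longleftrightarrow>
     (let E = {q. fst q < snd q \<and> snd q < length G \<and> q \<noteq> p \<and> (q \<in> T \<or> pair_coprime G q) \<and>
                  mdvd (LM (G ! fst q)) (pair_lcm G p) \<and> mdvd (LM (G ! snd q)) (pair_lcm G p)}
      in p \<in> (E \<union> E\<inverse>)\<^sup>*)"

text \<open>
  \<open>bb_run F s G P Q\<close>: starting from the input \<open>F\<close>, a computation with the normal selection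
  strategy can reach the current basis \<open>G\<close>, the set \<open>P\<close> of available pairs and the set \<open>Q\<close> of
  processed pairs, having performed the steps \<open>s\<close>. The list \<open>s\<close> records, in order, the degree of
  each selected pair and the remainder obtained from it.
\<close>

inductive bb_run ::
  "('v::linorder, 'k::field) pol list \<Rightarrow> (nat \<times> ('v, 'k) pol) list \<Rightarrow>
   ('v, 'k) pol list \<Rightarrow> (nat \<times> nat) set \<Rightarrow> (nat \<times> nat) set \<Rightarrow> bool"
  for F where
  init:
    "bb_run F [] F {(i, j). i < j \<and> j < length F} {}"
| discard:
    "bb_run F s G P Q \<Longrightarrow> p \<in> P \<Longrightarrow> pair_coprime G p \<or> unnecessary G (P \<union> Q) p \<Longrightarrow>
     bb_run F s G (P - {p}) Q"
| select_zero:
    "bb_run F s G P Q \<Longrightarrow> p \<in> P \<Longrightarrow> \<not> pair_coprime G p \<Longrightarrow>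
     \<forall>q\<in>P. \<not> drl_less (pair_lcm G q) (pair_lcm G p) \<Longrightarrow>
     remainder (set G) (spoly (G ! fst p) (G ! snd p)) 0 \<Longrightarrow>
     bb_run F (s @ [(mdeg (pair_lcm G p), 0)]) G (P - {p}) (insert p Q)"
| select_nonzero:
    "bb_run F s G P Q \<Longrightarrow> p \<in> P \<Longrightarrow> \<not> pair_coprime G p \<Longrightarrow>
     \<forall>q\<in>P. \<not> drl_less (pair_lcm G q) (pair_lcm G p) \<Longrightarrow>
     remainder (set G) (spoly (G ! fst p) (G ! snd p)) r \<Longrightarrow> r \<noteq> 0 \<Longrightarrow>
     bb_run F (s @ [(mdeg (pair_lcm G p), r)]) (G @ [r])
       ((P - {p}) \<union> {(i, length G) | i. i < length G}) (insert p Q)"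

definition buchberger_computation ::
  "('v::linorder, 'k::field) pol list \<Rightarrow> (nat \<times> ('v, 'k) pol) list \<Rightarrow> bool" where
  "buchberger_computation F s \<longleftrightarrow> (\<exists>G Q. bb_run F s G {} Q)"

abbreviation step_degree :: "(nat \<times> ('v, 'k) pol) list \<Rightarrow> nat \<Rightarrow> nat" where
  "step_degree s k \<equiv> fst (s ! k)"

definition degree_fall :: "(nat \<times> ('v, 'k::zero) pol) list \<Rightarrow> nat \<Rightarrow> bool" where
  "degree_fall s k \<longleftrightarrow> k < length s \<and> snd (s ! k) \<noteq> 0 \<and> tdeg (snd (s ! k)) < step_degree s k"

definition first_degree_fall :: "(nat \<times> ('v, 'k::zero) pol) list \<Rightarrow> nat \<Rightarrow> bool" where
  "first_degree_fall s k \<longleftrightarrow> degree_fall s k \<and> (\<forall>l<k. \<not> degree_fall s l)"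

text \<open>
  A fall among the steps that precede the first step of degree at least \<open>d0\<close>, that is, in the
  part of the computation that consists of the degrees below \<open>d0\<close>. After a degree fall the step
  degree may drop again, and falls at such later steps of small degree do not count here.
\<close>

definition degree_fall_below :: "(nat \<times> ('v, 'k::zero) pol) list \<Rightarrow> nat \<Rightarrow> bool" where
  "degree_fall_below s d0 \<longleftrightarrow> (\<exists>k. degree_fall s k \<and> (\<forall>l\<le>k. step_degree s l < d0))"

section \<open>Multiplication by y and the injectivity condition\<close>

definition ideal_cong :: "'a::comm_ring_1 set \<Rightarrow> ('a \<times> 'a) set" where
  "ideal_cong I = {(f, g). f - g \<in> I}"

text \<open>The degree \<open>d\<close> component of the quotient by the homogeneous ideal \<open>I\<close>.\<close>

definition quot_comp :: "('v, 'k::comm_ring_1) pol set \<Rightarrow> nat \<Rightarrow> ('v, 'k) pol set set" where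
  "quot_comp I d = {f. homogeneous d f} // ideal_cong I"

definition mult_y :: "('x option, 'k::comm_ring_1) pol set \<Rightarrow>
    ('x option, 'k) pol set \<Rightarrow> ('x option, 'k) pol set" where
  "mult_y I C = (\<Union>f\<in>C. ideal_cong I `` {monom ymon 1 * f})"

definition mult_y_injective :: "('x, 'k::comm_ring_1) pol list \<Rightarrow> nat \<Rightarrow> bool" where
  "mult_y_injective F d \<longleftrightarrow> inj_on (mult_y (hom_ideal F)) (quot_comp (hom_ideal F) (d - 1))"

definition d_inj :: "('x, 'k::comm_ring_1) pol list \<Rightarrow> enat" where
  "d_inj F = Inf {enat d | d. d \<ge> 1 \<and> \<not> mult_y_injective F d}"

definition monomial_ideal :: "'v mon set \<Rightarrow> ('v, 'k::comm_ring_1) pol set" where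
  "monomial_ideal B = ideal_of ((\<lambda>t. monom t 1) ` B)"

definition min_monomial_gens :: "('v, 'k::comm_ring_1) pol set \<Rightarrow> 'v mon set" where
  "min_monomial_gens J =
     (THE B. monomial_ideal B = J \<and> (\<forall>B'. B' \<subset> B \<longrightarrow> monomial_ideal B' \<noteq> J))"

definition LM_ideal :: "('v::linorder, 'k::comm_ring_1) pol set \<Rightarrow> ('v, 'k) pol set" where
  "LM_ideal I = monomial_ideal (LM ` (I - {0}))"

text \<open>The list \<open>s\<close> is the sequence of steps of a computation for the homogenized input.\<close>

definition injectivity_condition ::
  "('x::linorder, 'k::field) pol list \<Rightarrow> (nat \<times> ('x option, 'k) pol) list \<Rightarrow> nat \<Rightarrow> bool" where
  "injectivity_condition F s d0 \<longleftrightarrow> (\<forall>d. 1 \<le> d \<and> d < d0 \<longrightarrow>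
     mult_y_injective F d \<and>
     (\<forall>t \<in> min_monomial_gens (LM_ideal (hom_ideal F)). mdeg t = d \<longrightarrow> \<not> mdvd ymon t) \<and>
     (\<forall>k<length s. step_degree s k = d \<and> snd (s ! k) \<noteq> 0 \<longrightarrow> \<not> mdvd ymon (LM (snd (s ! k)))))"

end

theory Submission
  imports Defs
begin

text \<open>
  Write \<open>V d\<close> (in the code, \<open>deg_combs F d\<close>) for the space of all sums \<open>h\<^sub>1 f\<^sub>1 + \<dots> + h\<^sub>m f\<^sub>m\<close> in which no
  summand has degree above \<open>d\<close>. Homogenization in degree \<open>d\<close> identifies \<open>V d\<close> with the degree
  \<open>d\<close> component of the homogenized ideal, and the inclusion of \<open>V (d - 1)\<close> in \<open>V d\<close> with
  multiplication by \<open>y\<close>. Hence multiplication by \<open>y\<close> into degree \<open>d\<close> is injective exactly if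
  every element of \<open>V d\<close> of degree less than \<open>d\<close> already lies in \<open>V (d - 1)\<close>
  (\<open>mult_y_injective_iff_exact\<close>). This moves the question to the affine side.

  As long as no degree fall has happened, every basis element \<open>g\<close> lies in \<open>V (deg g)\<close>, and
  the selected degrees do not decrease (\<open>bb_run_invariant\<close>). If moreover all pairs of degree at most
  \<open>e\<close> have been treated, then Buchberger's argument, carried out only below degree \<open>e\<close>, gives each
  element \<open>p\<close> of \<open>V e\<close> a standard representation, in which no summand has a leading monomial above
  that of \<open>p\<close> (\<open>run_standard_representation\<close>). This has two consequences. Reading off degrees, the
  elements of \<open>V e\<close> of degree less than \<open>e\<close> lie in \<open>V (e - 1)\<close>, so injectivity holds in all
  degrees that have been passed without a fall. And a remainder \<open>r\<close> that falls at step degree \<open>d\<close>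
  is an element of \<open>V d\<close> that is not in \<open>V (d - 1)\<close>, for otherwise its leading monomial would be
  reducible by the current basis; so injectivity fails in degree \<open>d\<close>. Together, the first fall
  happens at the first degree in which injectivity fails
  (\<open>first_fall_at_first_inexact_degree\<close>), whatever choices the computation makes.

  In the injectivity condition, the other two parts follow from the injectivity of multiplication by
  \<open>y\<close>. In the degree reverse lexicographic ordering with \<open>y\<close> smallest, \<open>y\<close> divides a homogeneous
  polynomial as soon as it divides the leading monomial (\<open>divisible_by_y_if_LM\<close>). Cancelling \<open>y\<close>
  from an element of the ideal of degree \<open>d\<close> gives an element of the ideal of degree \<open>d - 1\<close> whose
  leading monomial properly divides the old one. Thus the old one is neither a minimal generator nor,
  the homogeneous computation having treated all pairs of degree less than \<open>d\<close>, that of a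
  remainder at step degree \<open>d\<close>.
\<close>

section \<open>Monomials and the degree reverse lexicographic ordering\<close>

abbreviation expo :: "'v mon \<Rightarrow> 'v \<Rightarrow> nat" where
  "expo \<equiv> Poly_Mapping.lookup"

abbreviation coeff :: "('v, 'k::zero) pol \<Rightarrow> 'v mon \<Rightarrow> 'k" where
  "coeff \<equiv> Poly_Mapping.lookup"

abbreviation supp :: "('v, 'k::zero) pol \<Rightarrow> 'v mon set" where
  "supp \<equiv> Poly_Mapping.keys"

lemma mdeg_sum: "mdeg (t :: 'v::finite mon) = (\<Sum>v\<in>UNIV. expo t v)"
  unfolding mdeg_def by (rule sum.mono_neutral_left) (auto simp: in_keys_iff)

lemma mdeg_add: "mdeg (s + t :: 'v::finite mon) = mdeg s + mdeg t"
  by (simp add: mdeg_sum lookup_add sum.distrib)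

lemma mdeg_0 [simp]: "mdeg 0 = 0"
  by (simp add: mdeg_def)

lemma mdvd_minus_add: "mdvd s t \<Longrightarrow> (t - s) + s = t"
  by (rule poly_mapping_eqI) (simp add: mdvd_def lookup_add lookup_minus)

lemma mdvdE:
  assumes "mdvd s t" obtains u where "t = u + s"
  using mdvd_minus_add[OF assms] by metis

lemma mdvd_refl [simp]: "mdvd s s"
  by (simp add: mdvd_def)

lemma mdvd_trans: "mdvd s t \<Longrightarrow> mdvd t u \<Longrightarrow> mdvd s u"
  unfolding mdvd_def using order_trans by blast

lemma mdvd_add [simp]: "mdvd s (u + s)" "mdvd s (s + u)"
  by (simp_all add: mdvd_def lookup_add)

lemma mdeg_mono: "mdvd s t \<Longrightarrow> mdeg (s :: 'v::finite mon) \<le> mdeg t"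
  by (auto simp: mdeg_add elim!: mdvdE)

lemma lookup_mlcm: "expo (mlcm s t) v = max (expo s v) (expo t v)"
  by (simp add: mlcm_def lookup_add lookup_minus max_def)

lemma mdvd_mlcm [simp]: "mdvd s (mlcm s t)" "mdvd t (mlcm s t)"
  by (simp_all add: mdvd_def lookup_mlcm)

lemma mlcm_least: "mdvd s u \<Longrightarrow> mdvd t u \<Longrightarrow> mdvd (mlcm s t) u"
  by (simp add: mdvd_def lookup_mlcm)

lemma mlcm_coprime:
  assumes "mcoprime s t"
  shows "mlcm s t = s + t"
proof (rule poly_mapping_eqI)
  fix v
  have "expo s v = 0 \<or> expo t v = 0"
    using assms by (auto simp: mcoprime_def in_keys_iff)
  then show "expo (mlcm s t) v = expo (s + t) v"
    by (auto simp: lookup_mlcm lookup_add)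
qed

definition drl_le :: "'v::linorder mon \<Rightarrow> 'v mon \<Rightarrow> bool" where
  "drl_le s t \<longleftrightarrow> s = t \<or> drl_less s t"

lemma drl_less_irrefl: "\<not> drl_less s s"
  by (simp add: drl_less_def)

lemma drl_less_mdeg: "drl_less s t \<Longrightarrow> mdeg s \<le> mdeg t"
  by (auto simp: drl_less_def)

lemma drl_less_trans:
  assumes st: "drl_less s t" and tu: "drl_less t u"
  shows "drl_less s u"
proof (cases "mdeg s = mdeg t \<and> mdeg t = mdeg u")
  case False
  then show ?thesis
    using drl_less_mdeg[OF st] drl_less_mdeg[OF tu] by (auto simp: drl_less_def)
next
  case True
  from st True obtain v where v: "expo s v > expo t v" "\<And>w. w < v \<Longrightarrow> expo s w = expo t w"
    by (auto simp: drl_less_def)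
  from tu True obtain v' where v': "expo t v' > expo u v'" "\<And>w. w < v' \<Longrightarrow> expo t w = expo u w"
    by (auto simp: drl_less_def)
  have "expo s (min v v') > expo u (min v v')"
    using v v' by (cases v v' rule: linorder_cases) (auto simp: min_def)
  moreover have "\<And>w. w < min v v' \<Longrightarrow> expo s w = expo u w"
    using v(2) v'(2) by simp
  ultimately show ?thesis
    using True by (auto simp: drl_less_def)
qed

lemma drl_less_total:
  assumes "s \<noteq> t"
  shows "drl_less s t \<or> drl_less t s"
proof (cases "mdeg s = mdeg t")
  case True
  define D where "D = {v \<in> Poly_Mapping.keys s \<union> Poly_Mapping.keys t. expo s v \<noteq> expo t v}"
  have D: "v \<in> D \<longleftrightarrow> expo s v \<noteq> expo t v" for v
    by (auto simp: D_def in_keys_iff)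
  have fin: "finite D" by (simp add: D_def)
  have "D \<noteq> {}"
    using assms D by (metis empty_iff poly_mapping_eqI)
  then have "Min D \<in> D" using fin by (rule Min_in[rotated])
  then have "expo s (Min D) > expo t (Min D) \<or> expo t (Min D) > expo s (Min D)"
    by (simp add: D) linarith
  moreover have "\<forall>w<Min D. expo s w = expo t w"
    using Min_le[OF fin] D by (metis leD)
  ultimately show ?thesis
    using True unfolding drl_less_def by metis
qed (auto simp: drl_less_def)

interpretation drl: linorder drl_le drl_less
proof
  show "drl_less s t \<longleftrightarrow> drl_le s t \<and> \<not> drl_le t s" for s t :: "'v::linorder mon"
    using drl_less_trans[of s t s] drl_less_irrefl[of s] by (auto simp: drl_le_def)
  show "drl_le s s" for s :: "'v::linorder mon"
    by (simp add: drl_le_def)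
  show "drl_le s t \<Longrightarrow> drl_le t u \<Longrightarrow> drl_le s u" for s t u :: "'v::linorder mon"
    using drl_less_trans[of s t u] by (auto simp: drl_le_def)
  show "drl_le s t \<Longrightarrow> drl_le t s \<Longrightarrow> s = t" for s t :: "'v::linorder mon"
    using drl_less_trans[of s t s] drl_less_irrefl[of s] by (auto simp: drl_le_def)
  show "drl_le s t \<or> drl_le t s" for s t :: "'v::linorder mon"
    using drl_less_total[of s t] by (auto simp: drl_le_def)
qed

lemma drl_le_mdeg: "drl_le s t \<Longrightarrow> mdeg s \<le> mdeg t"
  using drl_less_mdeg by (auto simp: drl_le_def)

lemma drl_less_add: "drl_less s t \<Longrightarrow> drl_less (u + s) (u + t :: 'v::{finite,linorder} mon)"
  by (auto simp: drl_less_def mdeg_add lookup_add)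

lemma drl_le_add: "drl_le s t \<Longrightarrow> drl_le (u + s) (u + t :: 'v::{finite,linorder} mon)"
  using drl_less_add by (auto simp: drl_le_def)

lemma finite_drl_below: "finite {s :: 'v::{finite,linorder} mon. drl_less s t}"
proof -
  let ?B = "{s :: 'v mon. drl_less s t}"
  have "expo s v \<le> mdeg t" if "drl_less s t" for s v
  proof -
    have "expo s v \<le> mdeg s"
      unfolding mdeg_sum by (rule member_le_sum) auto
    also have "mdeg s \<le> mdeg t"
      using that by (rule drl_less_mdeg)
    finally show ?thesis .
  qed
  then have "expo ` ?B \<subseteq> {f. \<forall>v. f v \<in> {..mdeg t}}"
    by auto
  moreover have "finite {f :: 'v \<Rightarrow> nat. \<forall>v. f v \<in> {..mdeg t}}"
    using finite_set_of_finite_funs[of "UNIV :: 'v set" "{..mdeg t}"] by simp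
  ultimately have "finite (expo ` ?B)"
    by (rule finite_subset)
  moreover have "inj_on expo ?B"
    by (rule inj_onI) (simp only: poly_mapping_eq_iff)
  ultimately show ?thesis
    by (rule finite_imageD)
qed

text \<open>
  Below a monomial there are only finitely many others, because the ordering refines the degree
  and there are finitely many variables; the number of monomials below is a termination measure.
\<close>

lemma drl_induct [case_names less]:
  fixes t :: "'v::{finite,linorder} mon"
  assumes "\<And>t. (\<And>s. drl_less s t \<Longrightarrow> P s) \<Longrightarrow> P t"
  shows "P t"
proof (induction t rule: measure_induct_rule[of "\<lambda>t. card {s. drl_less s t}"])
  case (less t)
  show ?case
  proof (rule assms, rule less)
    fix s assume "drl_less s t"
    then have "{r. drl_less r s} \<subset> {r. drl_less r t}"
      using drl.less_trans by auto
    then show "card {r. drl_less r s} < card {r. drl_less r t}"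
      by (rule psubset_card_mono[OF finite_drl_below])
  qed
qed

section \<open>Leading monomials\<close>

lemma LM_in_supp_and_max:
  assumes "p \<noteq> 0"
  shows "LM p \<in> supp p \<and> (\<forall>s\<in>supp p - {LM p}. drl_less s (LM p))"
  unfolding LM_def
proof (rule theI')
  show "\<exists>!t. t \<in> supp p \<and> (\<forall>s\<in>supp p - {t}. drl_less s t)"
  proof (rule ex_ex1I)
    have ne: "supp p \<noteq> {}" using assms by simp
    then have "drl.Max (supp p) \<in> supp p" by (simp add: drl.Max_in)
    moreover have "drl_less s (drl.Max (supp p))" if "s \<in> supp p - {drl.Max (supp p)}" for s
      using that ne by (simp add: drl.Max_ge drl.less_le)
    ultimately show "\<exists>t. t \<in> supp p \<and> (\<forall>s\<in>supp p - {t}. drl_less s t)" by blast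
  next
    show "t = u"
      if "t \<in> supp p \<and> (\<forall>s\<in>supp p - {t}. drl_less s t)"
        "u \<in> supp p \<and> (\<forall>s\<in>supp p - {u}. drl_less s u)" for t u
      using that drl.less_asym by blast
  qed
qed

lemma LM_in_supp: "p \<noteq> 0 \<Longrightarrow> LM p \<in> supp p"
  using LM_in_supp_and_max by blast

lemma LM_max: "s \<in> supp p \<Longrightarrow> drl_le s (LM p)"
  using LM_in_supp_and_max[of p] by (cases "p = 0") (auto simp: drl_le_def)

lemma LM_eqI: "t \<in> supp p \<Longrightarrow> (\<And>s. s \<in> supp p \<Longrightarrow> drl_le s t) \<Longrightarrow> LM p = t"
  by (metis LM_in_supp LM_max drl.order.antisym empty_iff keys_zero)

lemma LC_nonzero: "p \<noteq> 0 \<Longrightarrow> LC p \<noteq> 0"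
  using LM_in_supp[of p] by (simp add: LC_def in_keys_iff)

lemma tdeg_eq_mdeg_LM:
  assumes "p \<noteq> 0"
  shows "tdeg p = mdeg (LM p)"
  unfolding tdeg_def
proof (rule Max_eqI)
  show "mdeg (LM p) \<in> insert 0 (mdeg ` supp p)"
    using LM_in_supp[OF assms] by blast
qed (auto dest: LM_max drl_le_mdeg)

lemma lookup_monom_mult_add:
  "Poly_Mapping.lookup (monom t c * p) (t + s) = c * Poly_Mapping.lookup p (s :: 'v mon)"
proof -
  have "Poly_Mapping.lookup (monom t c * p) (t + s) =
      (\<Sum>l. (c when t = l) * (\<Sum>q. Poly_Mapping.lookup p q when t + s = l + q))"
    by (simp add: lookup_mult lookup_single)
  also have "\<dots> = (\<Sum>l. (c * (\<Sum>q. Poly_Mapping.lookup p q when t + s = l + q)) when l = t)"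
    by (rule Sum_any.cong) (auto simp: when_def)
  also have "\<dots> = c * (\<Sum>q. Poly_Mapping.lookup p q when s = q)"
    by simp
  finally show ?thesis by simp
qed

lemma supp_monom_mult: "supp (monom t c * p) \<subseteq> (+) t ` supp (p :: ('v, 'k::semiring_0) pol)"
  using keys_mult[of "monom t c" p] by (auto split: if_splits)

lemma supp_monom_mult_eq:
  "c \<noteq> 0 \<Longrightarrow> supp (monom t c * p) = (+) t ` supp (p :: ('v, 'k::field) pol)"
  using supp_monom_mult[of t c p] by (auto simp: in_keys_iff lookup_monom_mult_add)

lemma LM_monom_mult:
  fixes p :: "('v::{finite,linorder}, 'k::field) pol"
  assumes "c \<noteq> 0" "p \<noteq> 0"
  shows "LM (monom t c * p) = t + LM p"
  using assms by (intro LM_eqI) (auto simp: supp_monom_mult_eq intro: LM_in_supp LM_max drl_le_add)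

lemma sum_monoms: "(\<Sum>t\<in>supp p. monom t (coeff p t)) = (p :: ('v, 'k::comm_monoid_add) pol)"
  by (rule poly_mapping_eqI) (auto simp: lookup_sum lookup_single when_def in_keys_iff)

section \<open>Combinations with bounded leading monomials\<close>

text \<open>
  Bounding the leading monomials \<open>t + LM g\<close> of the summands by \<open>LM p\<close> gives the standard
  representations of \<open>p\<close>, bounding their degree by \<open>d\<close> gives the elements represented in degree
  \<open>d\<close>, and the ideal is the case of no bound.
\<close>

inductive_set combs ::
  "('v::{finite,linorder}, 'k::field) pol set \<Rightarrow> 'v mon set \<Rightarrow> ('v, 'k) pol set"
  for G S where
  combs_zero: "0 \<in> combs G S"
| combs_step: "p \<in> combs G S \<Longrightarrow> g \<in> G \<Longrightarrow> t + LM g \<in> S \<Longrightarrow> p + monom t c * g \<in> combs G S"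

abbreviation up_to :: "'v::linorder mon \<Rightarrow> 'v mon set" where
  "up_to M \<equiv> {m. drl_le m M}"

abbreviation below :: "'v::linorder mon \<Rightarrow> 'v mon set" where
  "below M \<equiv> {m. drl_less m M}"

abbreviation deg_combs :: "('v::{finite,linorder}, 'k::field) pol set \<Rightarrow> nat \<Rightarrow> ('v, 'k) pol set"
  where "deg_combs G d \<equiv> combs G {m. mdeg m \<le> d}"

lemma combs_single: "g \<in> G \<Longrightarrow> t + LM g \<in> S \<Longrightarrow> monom t c * g \<in> combs G S"
  using combs_step[OF combs_zero] by fastforce

lemma combs_member:
  assumes "g \<in> G" "LM g \<in> S"
  shows "g \<in> combs G S"
proof -
  have "monom 0 1 * g \<in> combs G S" using assms by (intro combs_single) auto
  then show ?thesis by simp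
qed

lemma combs_add:
  assumes "p \<in> combs G S" "q \<in> combs G S"
  shows "p + q \<in> combs G S"
  using assms(2,1) by (induction q) (auto simp: add.assoc[symmetric] intro: combs_step)

lemma combs_trans:
  assumes "p \<in> combs G S"
    and "\<And>g t c. g \<in> G \<Longrightarrow> t + LM g \<in> S \<Longrightarrow> monom t c * g \<in> combs G' S'"
  shows "p \<in> combs G' S'"
  using assms(1) by induction (auto intro: combs_zero combs_add assms(2))

lemma combs_mono:
  assumes "p \<in> combs G S" "G \<subseteq> G'" "S \<subseteq> S'"
  shows "p \<in> combs G' S'"
  using assms(1) by (rule combs_trans) (use assms(2,3) in \<open>auto intro: combs_single\<close>)

lemma combs_monom_mult:
  assumes "p \<in> combs G S" and S: "\<And>m. m \<in> S \<Longrightarrow> t + m \<in> S'"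
  shows "monom t c * p \<in> combs G S'"
  using assms(1)
proof induction
  case (combs_step p g s c')
  have "monom t c * (monom s c' * g) = monom (t + s) (c * c') * g"
    by (simp add: mult.assoc[symmetric] mult_single)
  moreover have "monom (t + s) (c * c') * g \<in> combs G S'"
    using combs_step S[of "s + LM g"] by (intro combs_single) (simp_all add: add.assoc)
  ultimately have "monom t c * (monom s c' * g) \<in> combs G S'"
    by (simp only:)
  then show ?case
    using combs_step.IH by (simp only: distrib_left combs_add)
qed (simp add: combs_zero)

lemma combs_scale: "p \<in> combs G S \<Longrightarrow> monom 0 c * p \<in> combs G S"
  by (rule combs_monom_mult) auto

lemma combs_uminus:
  assumes "p \<in> combs G S"
  shows "- p \<in> combs G S"
proof -
  have "monom 0 (- 1) * p = - p" by (simp add: single_uminus)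
  then show ?thesis using combs_scale[OF assms, of "- 1"] by simp
qed

lemma combs_diff: "p \<in> combs G S \<Longrightarrow> q \<in> combs G S \<Longrightarrow> p - q \<in> combs G S"
  using combs_add[OF _ combs_uminus] by fastforce

lemma combs_mult:
  assumes "\<And>s. s \<in> supp q \<Longrightarrow> monom s (coeff q s) * p \<in> combs G S"
  shows "q * p \<in> combs G S"
proof -
  have "(\<Sum>s\<in>X. monom s (coeff q s)) * p \<in> combs G S" if "finite X" "X \<subseteq> supp q" for X
    using that by induction (auto simp: distrib_right intro: combs_zero combs_add assms)
  from this[of "supp q"] show ?thesis by (simp add: sum_monoms)
qed

lemma combs_supp:
  assumes "p \<in> combs G S" "s \<in> supp p"
  shows "\<exists>m\<in>S. drl_le s m"
  using assms
proof induction
  case (combs_step p g t c)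
  show ?case
  proof (cases "s \<in> supp p")
    case False
    then have "s \<in> supp (monom t c * g)"
      using combs_step.prems keys_add[of p "monom t c * g"] by auto
    then obtain r where "r \<in> supp g" "s = t + r"
      using supp_monom_mult[of t c g] by auto
    then show ?thesis
      using combs_step.hyps by (auto intro: drl_le_add LM_max)
  qed (use combs_step in auto)
qed simp

text \<open>
  A combination has finitely many summands, so the largest leading monomial among them is an
  attained bound for all of them.
\<close>

lemma combs_bound:
  assumes "p \<in> combs G S"
  shows "p = 0 \<or> (\<exists>M\<in>S. p \<in> combs G (up_to M))"
  using assms
proof induction
  case (combs_step p g t c)
  let ?m = "t + LM g"
  have q: "monom t c * g \<in> combs G (up_to M)" if "drl_le ?m M" for M
    using combs_step that by (intro combs_single) auto
  show ?case
  proof (cases "p = 0")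
    case True
    then show ?thesis using q[of ?m] combs_step by auto
  next
    case False
    then obtain M where M: "M \<in> S" "p \<in> combs G (up_to M)"
      using combs_step by blast
    show ?thesis
    proof (cases "drl_le ?m M")
      case True
      then show ?thesis using M q combs_add by blast
    next
      case False
      then have "p \<in> combs G (up_to ?m)"
        using M(2) by (elim combs_mono) auto
      then show ?thesis using combs_step q[of ?m] combs_add by fastforce
    qed
  qed
qed simp

section \<open>Buchberger's criterion up to a degree bound\<close>

text \<open>
  The multiple of \<open>g\<close> with leading monomial \<open>M\<close> and leading coefficient 1. Differences of two of
  these are multiples of S-polynomials.
\<close>

definition multiple_at :: "'v::linorder mon \<Rightarrow> ('v, 'k::field) pol \<Rightarrow> ('v, 'k) pol" where
  "multiple_at M g = monom (M - LM g) (1 / LC g) * g"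

lemma spoly_eq_multiples:
  "spoly g h = multiple_at (mlcm (LM g) (LM h)) g - multiple_at (mlcm (LM g) (LM h)) h"
  by (simp add: spoly_def multiple_at_def Let_def)

lemma multiple_at_shift:
  assumes "mdvd (LM g) L"
  shows "multiple_at (u + L) g = monom u 1 * multiple_at L g"
proof -
  have "u + L - LM g = u + (L - LM g)"
    using assms by (intro poly_mapping_eqI) (simp add: lookup_add lookup_minus mdvd_def)
  then show ?thesis
    by (simp add: multiple_at_def mult.assoc[symmetric] mult_single)
qed

lemma coeff_multiple_at:
  assumes "g \<noteq> 0" "mdvd (LM g) M"
  shows "coeff (multiple_at M g) M = 1"
  using lookup_monom_mult_add[of "M - LM g" "1 / LC g" g "LM g"] assms
  by (simp add: multiple_at_def mdvd_minus_add LC_nonzero) (simp add: LC_def)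

lemma supp_multiple_at:
  fixes g :: "('v::{finite,linorder}, 'k::field) pol"
  assumes "mdvd (LM g) M" "s \<in> supp (multiple_at M g)"
  shows "drl_le s M"
proof -
  obtain r where "r \<in> supp g" "s = (M - LM g) + r"
    using assms(2) supp_monom_mult[of "M - LM g" "1 / LC g" g] by (auto simp: multiple_at_def)
  then show ?thesis
    using drl_le_add[OF LM_max, of r g "M - LM g"] mdvd_minus_add[OF assms(1)] by simp
qed

lemma supp_spoly:
  fixes g h :: "('v::{finite,linorder}, 'k::field) pol"
  assumes "g \<noteq> 0" "h \<noteq> 0" "s \<in> supp (spoly g h)"
  shows "drl_less s (mlcm (LM g) (LM h))"
proof -
  let ?L = "mlcm (LM g) (LM h)"
  have "s \<in> supp (multiple_at ?L g) \<or> s \<in> supp (multiple_at ?L h)"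
    using assms(3) by (auto simp: spoly_eq_multiples in_keys_iff lookup_minus)
  then have "drl_le s ?L"
    using supp_multiple_at[of g ?L s] supp_multiple_at[of h ?L s] by auto
  moreover have "coeff (spoly g h) ?L = 0"
    using assms by (simp add: spoly_eq_multiples lookup_minus coeff_multiple_at)
  then have "s \<noteq> ?L"
    using assms(3) by (auto simp: in_keys_iff)
  ultimately show ?thesis by (simp add: drl.less_le)
qed

text \<open>
  With \<open>g = LT g + g'\<close> and \<open>h = LT h + h'\<close>, the S-polynomial of coprime leading monomials is, up to
  a constant factor, \<open>LT h * g - LT g * h = g' * h - h' * g\<close>, and all terms of \<open>g'\<close> and \<open>h'\<close> are
  below the leading monomials.
\<close>

lemma product_criterion:
  fixes g h :: "('v::{finite,linorder}, 'k::field) pol"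
  assumes nz: "g \<noteq> 0" "h \<noteq> 0" and cop: "mcoprime (LM g) (LM h)"
  shows "spoly g h \<in> combs {g, h} (below (mlcm (LM g) (LM h)))"
proof -
  define rest :: "('v, 'k) pol \<Rightarrow> ('v, 'k) pol" where
    "rest f = f - monom (LM f) (LC f)" for f
  have rest_less: "drl_less s (LM f)" if "s \<in> supp (rest f)" for s f
  proof -
    have "s \<noteq> LM f"
      using that by (auto simp: rest_def in_keys_iff lookup_minus LC_def)
    moreover from this have "s \<in> supp f"
      using that by (simp add: rest_def in_keys_iff lookup_minus lookup_single_not_eq)
    ultimately show ?thesis by (simp add: LM_max drl.less_le)
  qed
  have L: "mlcm (LM g) (LM h) = LM g + LM h"
    using cop by (rule mlcm_coprime)
  have "LM g + LM h - LM g = LM h" "LM g + LM h - LM h = LM g"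
    by (intro poly_mapping_eqI; simp add: lookup_add lookup_minus)+
  then have S: "spoly g h = monom (LM h) (1 / LC g) * g - monom (LM g) (1 / LC h) * h"
    by (simp add: spoly_def L Let_def)
  let ?a = "monom 0 (1 / (LC g * LC h)) :: ('v, 'k) pol"
  have "?a * monom (LM h) (LC h) = monom (LM h) (1 / LC g)"
    "?a * monom (LM g) (LC g) = monom (LM g) (1 / LC h)"
    using LC_nonzero[OF nz(1)] LC_nonzero[OF nz(2)] by (simp_all add: mult_single)
  then have "spoly g h = ?a * (monom (LM h) (LC h) * g - monom (LM g) (LC g) * h)"
    unfolding S right_diff_distrib mult.assoc[symmetric] by simp
  also have "monom (LM h) (LC h) * g - monom (LM g) (LC g) * h = rest g * h - rest h * g"
    by (simp add: rest_def algebra_simps)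
  finally have "spoly g h = ?a * (rest g * h - rest h * g)" .
  moreover have less: "drl_less (s + LM f') (LM f + LM f')" if "s \<in> supp (rest f)" for s f f'
    using drl_less_add[OF rest_less[OF that], of "LM f'"] by (simp add: add.commute)
  have "rest g * h \<in> combs {g, h} (below (LM g + LM h))"
    by (rule combs_mult, rule combs_single) (simp_all add: less)
  moreover have "rest h * g \<in> combs {g, h} (below (LM h + LM g))"
    by (rule combs_mult, rule combs_single) (simp_all add: less)
  then have "rest h * g \<in> combs {g, h} (below (LM g + LM h))"
    by (simp only: add.commute[of "LM h"])
  ultimately show ?thesis
    by (simp add: L combs_scale combs_diff)
qed

text \<open>
  Differences of two multiples suffice here, because they generate all syzygies of leading terms
  in degree \<open>M\<close>.
\<close>

definition syzygies_lift_at :: "('v::{finite,linorder}, 'k::field) pol set \<Rightarrow> 'v mon \<Rightarrow> bool" where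
  "syzygies_lift_at G M \<longleftrightarrow> (\<forall>g\<in>G. \<forall>h\<in>G. mdvd (LM g) M \<longrightarrow> mdvd (LM h) M \<longrightarrow>
     multiple_at M g - multiple_at M h \<in> combs G (below M))"

lemma combs_below_if_not_divisible:
  assumes "p \<in> combs G (up_to M)" and nd: "\<And>g. g \<in> G \<Longrightarrow> \<not> mdvd (LM g) M"
  shows "p \<in> combs G (below M)"
  using assms(1)
proof (rule combs_trans)
  fix g t c
  assume g: "g \<in> G" "t + LM g \<in> up_to M"
  then have "t + LM g \<noteq> M" using nd[of g] by auto
  then show "monom t c * g \<in> combs G (below M)"
    using g by (intro combs_single) (auto simp: drl.less_le)
qed

text \<open>
  The top terms are all moved to the multiple of a single basis element, each at the cost of one
  difference that stays below \<open>M\<close>. What is then left at the top is \<open>coeff p M\<close> times that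
  multiple.
\<close>

lemma combs_cancel_top:
  fixes G :: "('v::{finite,linorder}, 'k::field) pol set"
  assumes nz: "0 \<notin> G" and syz: "syzygies_lift_at G M"
    and p: "p \<in> combs G (up_to M)" and top: "coeff p M = 0"
  shows "p \<in> combs G (below M)"
proof (cases "\<exists>h\<in>G. mdvd (LM h) M")
  case False
  then show ?thesis
    using p combs_below_if_not_divisible by blast
next
  case True
  then obtain h where h: "h \<in> G" "mdvd (LM h) M" by blast
  have "p - monom 0 (coeff p M) * multiple_at M h \<in> combs G (below M)"
    using p
  proof induction
    case combs_zero
    then show ?case by (simp add: combs.combs_zero)
  next
    case (combs_step p g t c)
    let ?q = "monom t c * g"
    have "?q - monom 0 (coeff ?q M) * multiple_at M h \<in> combs G (below M)"
    proof (cases "t + LM g = M")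
      case True
      then have g: "mdvd (LM g) M" by auto
      have "t = M - LM g" using True by auto
      moreover have "LC g \<noteq> 0" using combs_step.hyps nz by (metis LC_nonzero)
      ultimately have q: "?q = monom 0 (c * LC g) * multiple_at M g"
        by (simp add: multiple_at_def mult.assoc[symmetric] mult_single)
      have "coeff ?q M = c * LC g"
        using lookup_monom_mult_add[of t c g "LM g"] True by (simp add: LC_def)
      then have "?q - monom 0 (coeff ?q M) * multiple_at M h =
          monom 0 (c * LC g) * (multiple_at M g - multiple_at M h)"
        by (simp only: q right_diff_distrib)
      then show ?thesis
        using syz h g combs_step.hyps by (auto simp: syzygies_lift_at_def intro!: combs_scale)
    next
      case False
      then have less: "drl_less (t + LM g) M"
        using combs_step.hyps by (simp add: drl.less_le)
      then have q: "?q \<in> combs G (below M)"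
        using combs_step.hyps by (intro combs_single) auto
      have "M \<notin> supp ?q"
        using combs_supp[OF q, of M] by (auto dest: drl.le_less_trans)
      then show ?thesis
        using q by (simp add: in_keys_iff)
    qed
    then have "(p - monom 0 (coeff p M) * multiple_at M h) +
        (?q - monom 0 (coeff ?q M) * multiple_at M h) \<in> combs G (below M)"
      using combs_step.IH by (rule combs_add[rotated])
    then show ?case
      by (simp add: lookup_add single_add distrib_right algebra_simps)
  qed
  then show ?thesis using top by simp
qed

text \<open>
  The bound on the leading monomials of the summands can be lowered until it is attained by \<open>p\<close>
  itself. It starts at degree at most \<open>e\<close>, so syzygies of higher degree never enter.
\<close>

lemma standard_representation:
  fixes G :: "('v::{finite,linorder}, 'k::field) pol set"
  assumes nz: "0 \<notin> G" and syz: "\<And>M. mdeg M \<le> e \<Longrightarrow> syzygies_lift_at G M"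
    and p: "p \<in> deg_combs G e" "p \<noteq> 0"
  shows "p \<in> combs G (up_to (LM p))"
proof -
  have *: "p \<in> combs G (up_to M) \<Longrightarrow> mdeg M \<le> e \<Longrightarrow> p \<in> combs G (up_to (LM p))" for M
  proof (induction M rule: drl_induct)
    case (less M)
    show ?case
    proof (cases "coeff p M = 0")
      case False
      moreover have "drl_le s M" if "s \<in> supp p" for s
        using combs_supp[OF less.prems(1) that] drl.order_trans by blast
      ultimately have "LM p = M"
        by (intro LM_eqI) (auto simp: in_keys_iff)
      then show ?thesis using less.prems by simp
    next
      case True
      then have "p \<in> combs G (below M)"
        using combs_cancel_top nz syz less.prems by blast
      then obtain M' where "drl_less M' M" "p \<in> combs G (up_to M')"
        using combs_bound p(2) by blast
      then show ?thesis
        using less.IH less.prems(2) drl_less_mdeg by (meson le_trans)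
    qed
  qed
  show ?thesis using combs_bound[OF p(1)] p(2) * by auto
qed

lemma LM_divisible_if_standard_representation:
  assumes "p \<in> combs G (up_to (LM p))" "p \<noteq> 0"
  shows "\<exists>g\<in>G. mdvd (LM g) (LM p)"
proof (rule ccontr)
  assume "\<not> ?thesis"
  then have "p \<in> combs G (below (LM p))"
    using assms(1) combs_below_if_not_divisible by blast
  then show False
    using combs_supp[OF _ LM_in_supp[OF assms(2)]] drl.leD by blast
qed

section \<open>The computation before its first degree fall\<close>

lemma deg_combs_if_combs:
  assumes gens: "\<And>g. g \<in> G \<Longrightarrow> g \<in> deg_combs F (mdeg (LM g))"
    and p: "p \<in> combs G S" and S: "\<And>m. m \<in> S \<Longrightarrow> mdeg m \<le> d"
  shows "p \<in> deg_combs F d"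
  using p
proof (rule combs_trans)
  fix g t c
  assume g: "g \<in> G" "t + LM g \<in> S"
  then have "mdeg t + mdeg (LM g) \<le> d"
    using S by (fastforce simp: mdeg_add)
  then show "monom t c * g \<in> deg_combs F d"
    using gens[OF g(1)] by (intro combs_monom_mult[of g F]) (auto simp: mdeg_add)
qed

lemma red_steps_combs:
  fixes G :: "('v::{finite,linorder}, 'k::field) pol set"
  assumes "(red_step G)\<^sup>*\<^sup>* p q" "supp p \<subseteq> below L"
  shows "supp q \<subseteq> below L \<and> p - q \<in> combs G (below L)"
  using assms(1)
proof induction
  case base
  then show ?case using assms(2) by (simp add: combs_zero)
next
  case (step q r)
  then obtain g t where g: "g \<in> G" "t \<in> supp q" "mdvd (LM g) t"
    and r: "r = q - monom (t - LM g) (coeff q t / LC g) * g"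
    by (auto simp: red_step_def)
  have "(t - LM g) + LM g \<in> below L"
    using g step.IH mdvd_minus_add[OF g(3)] by auto
  then have c: "monom (t - LM g) (coeff q t / LC g) * g \<in> combs G (below L)"
    using g(1) by (intro combs_single)
  have "s \<in> below L" if "s \<in> supp r" for s
  proof (cases "s \<in> supp q")
    case False
    then have "s \<in> supp (monom (t - LM g) (coeff q t / LC g) * g)"
      using that by (auto simp: r in_keys_iff lookup_minus)
    then show ?thesis
      using combs_supp[OF c] drl.le_less_trans by blast
  qed (use step.IH in auto)
  moreover have "p - r = (p - q) + monom (t - LM g) (coeff q t / LC g) * g"
    by (simp add: r)
  ultimately show ?case
    using combs_add[OF conjunct2[OF step.IH] c] by (auto simp only:)
qed

lemma remainder_of_spoly:
  fixes g h :: "('v::{finite,linorder}, 'k::field) pol"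
  assumes "0 \<notin> G" "g \<in> G" "h \<in> G" and rem: "remainder G (spoly g h) r"
  defines "L \<equiv> mlcm (LM g) (LM h)"
  shows "spoly g h - r \<in> combs G (below L)" "supp r \<subseteq> below L" "r \<in> combs G (up_to L)"
proof -
  have "g \<noteq> 0" "h \<noteq> 0" using assms(1-3) by auto
  then have "supp (spoly g h) \<subseteq> below L"
    using supp_spoly[of g h] by (auto simp: L_def)
  with rem show *: "spoly g h - r \<in> combs G (below L)" "supp r \<subseteq> below L"
    using red_steps_combs unfolding remainder_def by blast+
  have "multiple_at L f \<in> combs G (up_to L)" if "f \<in> G" "mdvd (LM f) L" for f
    unfolding multiple_at_def using that by (intro combs_single) (simp_all add: mdvd_minus_add)
  then have "spoly g h \<in> combs G (up_to L)"
    using assms(2,3) by (simp add: spoly_eq_multiples L_def combs_diff)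
  moreover have "spoly g h - r \<in> combs G (up_to L)"
    using * by (elim combs_mono) auto
  ultimately show "r \<in> combs G (up_to L)"
    using combs_diff by fastforce
qed

text \<open>
  The steps that a chain of basis elements with leading monomials dividing \<open>M\<close> may take. All that
  matters about the discarded pairs is that any two indices stay joined by a chain in which every
  leading monomial divides the lcm of the two.
\<close>

definition links ::
  "('v::linorder, 'k::zero) pol list \<Rightarrow> (nat \<times> nat) set \<Rightarrow> 'v mon \<Rightarrow> (nat \<times> nat) set" where
  "links G T M = {q. fst q < snd q \<and> snd q < length G \<and> (q \<in> T \<or> pair_coprime G q) \<and>
     mdvd (LM (G ! fst q)) M \<and> mdvd (LM (G ! snd q)) M}"

abbreviation link_chains :: "(nat \<times> nat) set \<Rightarrow> (nat \<times> nat) set" where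
  "link_chains E \<equiv> (E \<union> E\<inverse>)\<^sup>*"

definition all_linked :: "('v::linorder, 'k::zero) pol list \<Rightarrow> (nat \<times> nat) set \<Rightarrow> bool" where
  "all_linked G T \<longleftrightarrow>
     (\<forall>i j. i < j \<and> j < length G \<longrightarrow> (i, j) \<in> link_chains (links G T (pair_lcm G (i, j))))"

lemma link_chains_mono: "E \<subseteq> link_chains E' \<Longrightarrow> link_chains E \<subseteq> link_chains E'"
proof -
  assume E: "E \<subseteq> link_chains E'"
  have "sym (link_chains E')" by (intro sym_rtrancl sym_Un_converse)
  then have "E \<union> E\<inverse> \<subseteq> link_chains E'"
    using E by (auto dest: symD)
  then show ?thesis by (metis rtrancl_subset_rtrancl)
qed

lemma in_link_chains: "p \<in> E \<Longrightarrow> p \<in> link_chains E"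
  by (cases p) auto

text \<open>
  A chain that runs through the discarded pair is rerouted along the chain that made the pair
  unnecessary; the lcm of the pair divides the bound of the old chain, so the new one obeys it too.
\<close>

lemma all_linked_discard:
  assumes linked: "all_linked G T" and dis: "pair_coprime G p \<or> unnecessary G T p"
    and T': "T - {p} \<subseteq> T'"
  shows "all_linked G T'"
  unfolding all_linked_def
proof (intro allI impI)
  fix i j assume ij: "i < j \<and> j < length G"
  let ?L = "pair_lcm G (i, j)"
  have "q \<in> link_chains (links G T' ?L)" if q: "q \<in> links G T ?L" for q
  proof (cases "q = p \<and> \<not> pair_coprime G p")
    case False
    then have "q \<in> links G T' ?L"
      using q T' by (auto simp: links_def)
    then show ?thesis by (rule in_link_chains)
  next
    case True
    let ?E = "links G T (pair_lcm G p) - {p}"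
    have "?E = {q. fst q < snd q \<and> snd q < length G \<and> q \<noteq> p \<and> (q \<in> T \<or> pair_coprime G q) \<and>
        mdvd (LM (G ! fst q)) (pair_lcm G p) \<and> mdvd (LM (G ! snd q)) (pair_lcm G p)}"
      by (auto simp: links_def)
    then have "p \<in> link_chains ?E"
      using dis True by (simp add: unnecessary_def Let_def)
    moreover have "mdvd (pair_lcm G p) ?L"
      using q True by (auto simp: links_def intro: mlcm_least)
    then have "?E \<subseteq> links G T' ?L"
      using T' by (auto simp: links_def intro: mdvd_trans)
    then have "link_chains ?E \<subseteq> link_chains (links G T' ?L)"
      using in_link_chains by (intro link_chains_mono) blast
    ultimately show ?thesis using True by blast
  qed
  then have "link_chains (links G T ?L) \<subseteq> link_chains (links G T' ?L)"
    by (intro link_chains_mono) blast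
  then show "(i, j) \<in> link_chains (links G T' ?L)"
    using linked ij by (auto simp: all_linked_def)
qed

lemma all_linked_append:
  assumes linked: "all_linked G T" and T': "T \<subseteq> T'" "{(i, length G) | i. i < length G} \<subseteq> T'"
  shows "all_linked (G @ [r]) T'"
  unfolding all_linked_def
proof (intro allI impI)
  fix i j assume ij: "i < j \<and> j < length (G @ [r])"
  let ?L = "pair_lcm (G @ [r]) (i, j)"
  show "(i, j) \<in> link_chains (links (G @ [r]) T' ?L)"
  proof (cases "j < length G")
    case True
    then have L: "?L = pair_lcm G (i, j)"
      using ij by (simp add: nth_append)
    have "links G T (pair_lcm G (i, j)) \<subseteq> links (G @ [r]) T' ?L"
      unfolding L using T'(1) by (auto simp: links_def nth_append)
    then have "link_chains (links G T (pair_lcm G (i, j))) \<subseteq> link_chains (links (G @ [r]) T' ?L)"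
      using in_link_chains by (intro link_chains_mono) blast
    then show ?thesis
      using linked ij True by (auto simp: all_linked_def)
  next
    case False
    then have "(i, j) \<in> links (G @ [r]) T' ?L"
      using ij T'(2) by (auto simp: links_def)
    then show ?thesis by (rule in_link_chains)
  qed
qed

text \<open>
  Differences of two multiples with the same leading term \<open>M\<close> add up along a chain, and for a
  processed or coprime pair the difference is a multiple of its S-polynomial. A pair that is still
  available cannot occur in the chain, as its degree exceeds that of \<open>M\<close>.
\<close>

lemma syzygies_lift_if_linked:
  fixes G :: "('v::{finite,linorder}, 'k::field) pol list"
  assumes nz: "0 \<notin> set G" and linked: "all_linked G (P \<union> Q)"
    and processed: "\<And>q. q \<in> Q \<Longrightarrow>
      spoly (G ! fst q) (G ! snd q) \<in> combs (set G) (below (pair_lcm G q))"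
    and avail: "\<And>q. q \<in> P \<Longrightarrow> mdeg M < mdeg (pair_lcm G q)"
  shows "syzygies_lift_at (set G) M"
proof -
  define R where
    "R = {(a, b). multiple_at M (G ! a) - multiple_at M (G ! b) \<in> combs (set G) (below M)}"
  have R_refl: "(a, a) \<in> R" for a
    by (simp add: R_def combs_zero)
  have R_sym: "(a, b) \<in> R \<Longrightarrow> (b, a) \<in> R" for a b
    using combs_uminus[of "multiple_at M (G ! a) - multiple_at M (G ! b)"] by (simp add: R_def)
  have R_trans: "(a, b) \<in> R \<Longrightarrow> (b, c) \<in> R \<Longrightarrow> (a, c) \<in> R" for a b c
    using combs_add[of "multiple_at M (G ! a) - multiple_at M (G ! b)" "set G" "below M"
        "multiple_at M (G ! b) - multiple_at M (G ! c)"]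
    by (simp add: R_def)
  have link: "q \<in> R" if q: "q \<in> links G (P \<union> Q) M" for q
  proof -
    obtain a b where ab: "q = (a, b)" by (cases q)
    let ?L = "pair_lcm G q"
    have len: "a < length G" "b < length G"
      using q by (auto simp: links_def ab)
    have "mdvd ?L M"
      using q by (auto simp: links_def intro: mlcm_least)
    then obtain u where u: "M = u + ?L" by (rule mdvdE)
    have "q \<notin> P"
      using avail mdeg_mono[OF \<open>mdvd ?L M\<close>] by fastforce
    then have "q \<in> Q \<or> pair_coprime G q"
      using q by (auto simp: links_def)
    then have S: "spoly (G ! a) (G ! b) \<in> combs (set G) (below ?L)"
    proof
      assume "pair_coprime G q"
      then have "spoly (G ! a) (G ! b) \<in> combs {G ! a, G ! b} (below ?L)"
        using product_criterion[of "G ! a" "G ! b"] len nz by (metis ab fst_conv nth_mem snd_conv)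
      then show ?thesis
        using len by (elim combs_mono) auto
    qed (use processed ab in force)
    have "multiple_at M (G ! a) - multiple_at M (G ! b) = monom u 1 * spoly (G ! a) (G ! b)"
      unfolding u spoly_eq_multiples by (simp add: ab multiple_at_shift right_diff_distrib)
    also have "\<dots> \<in> combs (set G) (below M)"
      using S by (rule combs_monom_mult) (simp add: u drl_less_add)
    finally show ?thesis by (simp add: R_def ab)
  qed
  have chain: "(a, b) \<in> R" if "(a, b) \<in> link_chains (links G (P \<union> Q) M)" for a b
    using that by induction (auto intro: R_refl R_sym R_trans dest: link)
  have "(i, j) \<in> R" if "i < j" "j < length G" "mdvd (LM (G ! i)) M" "mdvd (LM (G ! j)) M" for i j
  proof (rule chain)
    have "mdvd (pair_lcm G (i, j)) M"
      using that by (simp add: mlcm_least)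
    then have "links G (P \<union> Q) (pair_lcm G (i, j)) \<subseteq> links G (P \<union> Q) M"
      by (auto simp: links_def intro: mdvd_trans)
    then have "link_chains (links G (P \<union> Q) (pair_lcm G (i, j))) \<subseteq> link_chains (links G (P \<union> Q) M)"
      using in_link_chains by (intro link_chains_mono) blast
    then show "(i, j) \<in> link_chains (links G (P \<union> Q) M)"
      using linked that by (auto simp: all_linked_def)
  qed
  then have "(i, j) \<in> R"
    if "i < length G" "j < length G" "mdvd (LM (G ! i)) M" "mdvd (LM (G ! j)) M" for i j
    using that R_refl R_sym by (cases i j rule: linorder_cases) auto
  then show ?thesis
    by (auto simp: syzygies_lift_at_def R_def in_set_conv_nth)
qed

definition no_falls :: "(nat \<times> ('v, 'k::zero) pol) list \<Rightarrow> bool" where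
  "no_falls s \<longleftrightarrow> (\<forall>k. \<not> degree_fall s k)"

lemma no_falls_append:
  "no_falls (s @ [(d, r)]) \<longleftrightarrow> no_falls s \<and> (r = 0 \<or> d \<le> tdeg r)"
proof -
  have "degree_fall (s @ [(d, r)]) k \<longleftrightarrow>
      degree_fall s k \<or> k = length s \<and> r \<noteq> 0 \<and> tdeg r < d" for k
    by (auto simp: degree_fall_def nth_append)
  then show ?thesis by (auto simp: no_falls_def)
qed

text \<open>
  Without a degree fall, each basis element of degree \<open>e\<close> is a combination of the input in degree
  \<open>e\<close>, because a remainder inherits such a representation from its S-pair and has the same degree.
  The selected degrees never decrease, because a pair with a new element of degree \<open>e\<close> has
  degree at least \<open>e\<close>. The S-polynomial of a processed pair has a representation below the lcm even
  if its remainder is nonzero, as the remainder is then itself in the basis.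
\<close>

definition run_invariant ::
  "('v::{finite,linorder}, 'k::field) pol list \<Rightarrow> (nat \<times> ('v, 'k) pol) list \<Rightarrow>
   ('v, 'k) pol list \<Rightarrow> (nat \<times> nat) set \<Rightarrow> (nat \<times> nat) set \<Rightarrow> bool" where
  "run_invariant F s G P Q \<longleftrightarrow>
     set F \<subseteq> set G \<and> 0 \<notin> set G \<and> (\<forall>g\<in>set G. g \<in> deg_combs (set F) (mdeg (LM g))) \<and>
     (\<forall>q\<in>P \<union> Q. fst q < length G \<and> snd q < length G) \<and>
     (\<forall>q\<in>Q. spoly (G ! fst q) (G ! snd q) \<in> combs (set G) (below (pair_lcm G q))) \<and>
     all_linked G (P \<union> Q) \<and>
     sorted (map fst s) \<and> (\<forall>d\<in>set (map fst s). \<forall>q\<in>P. d \<le> mdeg (pair_lcm G q))"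

lemma select_in_degree:
  assumes inv: "run_invariant F s G P Q" and p: "p \<in> P"
    and rem: "remainder (set G) (spoly (G ! fst p) (G ! snd p)) r"
  defines "d \<equiv> mdeg (pair_lcm G p)"
  shows "r \<in> deg_combs (set F) d" "r \<noteq> 0 \<Longrightarrow> mdeg (LM r) \<le> d"
proof -
  have G: "0 \<notin> set G" "G ! fst p \<in> set G" "G ! snd p \<in> set G"
    using inv p by (auto simp: run_invariant_def)
  show "r \<in> deg_combs (set F) d"
    using inv by (intro deg_combs_if_combs[OF _ remainder_of_spoly(3)[OF G rem]])
      (auto simp: run_invariant_def d_def drl_le_mdeg)
  show "mdeg (LM r) \<le> d" if "r \<noteq> 0"
    using remainder_of_spoly(2)[OF G rem] LM_in_supp[OF that] drl_less_mdeg by (force simp: d_def)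
qed

lemma run_invariant_select:
  assumes inv: "run_invariant F s G P Q" and p: "p \<in> P"
    and min: "\<forall>q\<in>P. \<not> drl_less (pair_lcm G q) (pair_lcm G p)"
    and rem: "remainder (set G) (spoly (G ! fst p) (G ! snd p)) r"
  shows "r = 0 \<Longrightarrow> run_invariant F (s @ [(mdeg (pair_lcm G p), 0)]) G (P - {p}) (insert p Q)"
    and "r \<noteq> 0 \<Longrightarrow> mdeg (pair_lcm G p) \<le> tdeg r \<Longrightarrow>
      run_invariant F (s @ [(mdeg (pair_lcm G p), r)]) (G @ [r])
        ((P - {p}) \<union> {(i, length G) | i. i < length G}) (insert p Q)"
proof -
  let ?d = "mdeg (pair_lcm G p)" and ?S = "spoly (G ! fst p) (G ! snd p)"
  have G: "0 \<notin> set G" "G ! fst p \<in> set G" "G ! snd p \<in> set G"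
    using inv p by (auto simp: run_invariant_def)
  have le: "?d \<le> mdeg (pair_lcm G q)" if "q \<in> P" for q
    using min that drl.leI drl_le_mdeg by blast
  have s: "sorted (map fst (s @ [(?d, r')]))" for r'
    using inv p by (auto simp: run_invariant_def sorted_append)
  have T: "insert p (P - {p} \<union> Q) = P \<union> Q" using p by auto
  show "run_invariant F (s @ [(?d, 0)]) G (P - {p}) (insert p Q)" if "r = 0"
    using remainder_of_spoly(1)[OF G rem] inv p le s that
    by (auto simp: run_invariant_def T simp del: sorted_append)
  show "run_invariant F (s @ [(?d, r)]) (G @ [r])
      ((P - {p}) \<union> {(i, length G) | i. i < length G}) (insert p Q)"
    if r: "r \<noteq> 0" and deg: "?d \<le> tdeg r"
  proof -
    let ?P = "(P - {p}) \<union> {(i, length G) | i. i < length G}"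
    have deg_r: "mdeg (LM r) = ?d"
      using select_in_degree(2)[OF inv p rem r] deg r by (simp add: tdeg_eq_mdeg_LM)
    have old: "pair_lcm (G @ [r]) q = pair_lcm G q"
      "(G @ [r]) ! fst q = G ! fst q" "(G @ [r]) ! snd q = G ! snd q" if "q \<in> P \<union> Q" for q
      using inv that by (auto simp: run_invariant_def nth_append)
    have linked: "all_linked (G @ [r]) (?P \<union> insert p Q)"
      using inv p by (intro all_linked_append[of G "P \<union> Q"]) (auto simp: run_invariant_def)
    have lifts: "spoly ((G @ [r]) ! fst q) ((G @ [r]) ! snd q)
        \<in> combs (set (G @ [r])) (below (pair_lcm (G @ [r]) q))" if "q \<in> insert p Q" for q
    proof (cases "q = p")
      case False
      then have "spoly (G ! fst q) (G ! snd q) \<in> combs (set G) (below (pair_lcm G q))"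
        using that inv by (auto simp: run_invariant_def)
      then show ?thesis
        using False that by (subst old; simp?)+ (auto elim: combs_mono)
    next
      case True
      have "LM r \<in> below (pair_lcm G p)"
        using remainder_of_spoly(2)[OF G rem] LM_in_supp[OF r] by auto
      then have "r \<in> combs (set (G @ [r])) (below (pair_lcm G p))"
        by (intro combs_member) auto
      moreover have "?S - r \<in> combs (set (G @ [r])) (below (pair_lcm G p))"
        using remainder_of_spoly(1)[OF G rem] by (elim combs_mono) auto
      ultimately have "?S \<in> combs (set (G @ [r])) (below (pair_lcm G p))"
        using combs_add by fastforce
      then show ?thesis
        using True p old[of p] by simp
    qed
    have ord: "d' \<le> mdeg (pair_lcm (G @ [r]) q)"
      if d': "d' \<in> set (map fst (s @ [(?d, r)]))" and q: "q \<in> ?P" for d' q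
    proof (cases "q \<in> P")
      case True
      then have "d' \<le> mdeg (pair_lcm G q)"
        using d' le inv by (auto simp: run_invariant_def)
      then show ?thesis using old(1)[of q] True by simp
    next
      case False
      have "d' \<le> ?d"
        using d' inv p by (auto simp: run_invariant_def)
      moreover have "mdvd (LM r) (pair_lcm (G @ [r]) q)"
        using q False by auto
      ultimately show ?thesis
        using mdeg_mono deg_r by fastforce
    qed
    have gens: "g \<in> deg_combs (set F) (mdeg (LM g))" if "g \<in> set (G @ [r])" for g
      using that inv select_in_degree(1)[OF inv p rem] by (auto simp: run_invariant_def deg_r)
    have bound: "fst q < length (G @ [r])" "snd q < length (G @ [r])"
      if "q \<in> ?P \<union> insert p Q" for q
    proof -
      have "fst q < length G \<and> snd q < length G" if "q \<in> P \<union> Q"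
        using inv that by (auto simp: run_invariant_def)
      then show "fst q < length (G @ [r])" "snd q < length (G @ [r])"
        using that p by auto
    qed
    have sub: "set F \<subseteq> set (G @ [r])" "0 \<notin> set (G @ [r])"
      using inv r by (auto simp: run_invariant_def)
    show ?thesis
      unfolding run_invariant_def by (intro conjI ballI sub gens bound lifts linked s ord)
  qed
qed

lemma bb_run_invariant:
  assumes "bb_run F s G P Q" "0 \<notin> set F" "no_falls s"
  shows "run_invariant F s G P Q"
  using assms
proof (induction rule: bb_run.induct)
  case init
  have "all_linked F {(i, j). i < j \<and> j < length F}"
    unfolding all_linked_def by (auto intro!: r_into_rtrancl simp: links_def)
  moreover have "f \<in> deg_combs (set F) (mdeg (LM f))" if "f \<in> set F" for f
    using that by (intro combs_member) auto
  ultimately show ?case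
    using init by (auto simp: run_invariant_def)
next
  case (discard s G P Q p)
  then have inv: "run_invariant F s G P Q" by blast
  then have "all_linked G (P \<union> Q)" by (simp add: run_invariant_def)
  then have "all_linked G (P - {p} \<union> Q)"
    using discard.hyps(3) by (rule all_linked_discard) blast
  then show ?case
    using inv unfolding run_invariant_def by blast
next
  case (select_zero s G P Q p)
  then have "run_invariant F s G P Q" by (simp add: no_falls_append)
  then show ?case
    using select_zero.hyps by (intro run_invariant_select(1)) auto
next
  case (select_nonzero s G P Q p r)
  then have "run_invariant F s G P Q" "mdeg (pair_lcm G p) \<le> tdeg r"
    by (simp_all add: no_falls_append)
  then show ?case
    using select_nonzero.hyps by (intro run_invariant_select(2))
qed

section \<open>The first degree fall\<close>

text \<open>
  The affine form of the injectivity of multiplication by \<open>y\<close> into degree \<open>d\<close>. Since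
  \<open>0 - 1 = 0\<close>, it is void in degree 0.
\<close>

definition exact_in_degree :: "('v::{finite,linorder}, 'k::field) pol set \<Rightarrow> nat \<Rightarrow> bool" where
  "exact_in_degree F d \<longleftrightarrow>
     (\<forall>p\<in>deg_combs F d. (\<forall>t\<in>supp p. mdeg t \<le> d - 1) \<longrightarrow> p \<in> deg_combs F (d - 1))"

lemma run_standard_representation:
  assumes inv: "run_invariant F s G P Q" and avail: "\<And>q. q \<in> P \<Longrightarrow> e < mdeg (pair_lcm G q)"
    and p: "p \<in> deg_combs (set F) e" "p \<noteq> 0"
  shows "p \<in> combs (set G) (up_to (LM p))"
proof (rule standard_representation[where e = e])
  show "0 \<notin> set G" using inv by (simp add: run_invariant_def)
  show "p \<in> deg_combs (set G) e"
    using p(1) inv by (elim combs_mono) (auto simp: run_invariant_def)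
  show "syzygies_lift_at (set G) M" if "mdeg M \<le> e" for M
  proof (rule syzygies_lift_if_linked[of G P Q])
    show "mdeg M < mdeg (pair_lcm G q)" if "q \<in> P" for q
      using avail[OF that] \<open>mdeg M \<le> e\<close> by simp
  qed (use inv in \<open>auto simp: run_invariant_def\<close>)
qed (rule p(2))

text \<open>
  In a standard representation of \<open>p\<close> no summand has degree above that of \<open>p\<close>, and by the invariant
  the basis elements can be replaced by the input without raising degrees.
\<close>

lemma exact_if_pairs_processed:
  assumes inv: "run_invariant F s G P Q" and avail: "\<And>q. q \<in> P \<Longrightarrow> d < mdeg (pair_lcm G q)"
  shows "exact_in_degree (set F) d"
  unfolding exact_in_degree_def
proof (intro ballI impI)
  fix p assume p: "p \<in> deg_combs (set F) d" and deg: "\<forall>t\<in>supp p. mdeg t \<le> d - 1"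
  show "p \<in> deg_combs (set F) (d - 1)"
  proof (cases "p = 0")
    case False
    have "p \<in> combs (set G) (up_to (LM p))"
      using run_standard_representation[OF inv _ p False] avail by blast
    then show ?thesis
    proof (rule deg_combs_if_combs[rotated])
      show "mdeg m \<le> d - 1" if "m \<in> up_to (LM p)" for m
        using that deg LM_in_supp[OF False] drl_le_mdeg by fastforce
    qed (use inv in \<open>auto simp: run_invariant_def\<close>)
  qed (simp add: combs_zero)
qed

text \<open>
  A remainder that falls cannot be a combination in the lower degree: it would have a standard
  representation by the current basis, and so its leading monomial would be reducible.
\<close>

lemma not_exact_at_fall:
  assumes inv: "run_invariant F s G P Q" and p: "p \<in> P"
    and min: "\<forall>q\<in>P. \<not> drl_less (pair_lcm G q) (pair_lcm G p)"
    and rem: "remainder (set G) (spoly (G ! fst p) (G ! snd p)) r"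
    and fall: "r \<noteq> 0" "tdeg r < mdeg (pair_lcm G p)"
  shows "\<not> exact_in_degree (set F) (mdeg (pair_lcm G p))"
proof
  let ?d = "mdeg (pair_lcm G p)"
  assume "exact_in_degree (set F) ?d"
  moreover have "r \<in> deg_combs (set F) ?d"
    using select_in_degree(1)[OF inv p rem] .
  moreover have "mdeg t \<le> ?d - 1" if "t \<in> supp r" for t
    using LM_max[OF that] drl_le_mdeg fall by (fastforce simp: tdeg_eq_mdeg_LM)
  ultimately have "r \<in> deg_combs (set F) (?d - 1)"
    by (auto simp: exact_in_degree_def)
  moreover have "?d - 1 < mdeg (pair_lcm G q)" if "q \<in> P" for q
  proof -
    have "?d \<le> mdeg (pair_lcm G q)"
      using min that drl.leI drl_le_mdeg by blast
    then show ?thesis using fall(2) by simp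
  qed
  ultimately have "r \<in> combs (set G) (up_to (LM r))"
    using run_standard_representation[OF inv] fall(1) by blast
  then obtain g where "g \<in> set G" "mdvd (LM g) (LM r)"
    using LM_divisible_if_standard_representation fall(1) by blast
  then show False
    using rem LM_in_supp[OF fall(1)] by (auto simp: remainder_def)
qed

text \<open>
  The invariant is only available before the first fall, so statements about that fall are proved in
  the state just before the step.
\<close>

lemma bb_run_at_step:
  assumes "bb_run F s G P Q" "k < length s"
  obtains G' P' Q' p where "bb_run F (take k s) G' P' Q'" "p \<in> P'"
    "\<forall>q\<in>P'. \<not> drl_less (pair_lcm G' q) (pair_lcm G' p)"
    "\<not> pair_coprime G' p" "step_degree s k = mdeg (pair_lcm G' p)"
    "remainder (set G') (spoly (G' ! fst p) (G' ! snd p)) (snd (s ! k))"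
proof -
  have "\<exists>G' P' Q' p. bb_run F (take k s) G' P' Q' \<and> p \<in> P' \<and>
    (\<forall>q\<in>P'. \<not> drl_less (pair_lcm G' q) (pair_lcm G' p)) \<and>
    \<not> pair_coprime G' p \<and> step_degree s k = mdeg (pair_lcm G' p) \<and>
    remainder (set G') (spoly (G' ! fst p) (G' ! snd p)) (snd (s ! k))"
    using assms
  proof (induction rule: bb_run.induct)
    case (select_zero s G P Q p)
    then show ?case
    proof (cases "k < length s")
      case False
      then have "k = length s" using select_zero.prems by simp
      then show ?thesis using select_zero.hyps
        by (intro exI[of _ G] exI[of _ P] exI[of _ Q] exI[of _ p]) simp
    qed (simp add: nth_append)
  next
    case (select_nonzero s G P Q p r)
    then show ?case
    proof (cases "k < length s")
      case False
      then have "k = length s" using select_nonzero.prems by simp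
      then show ?thesis using select_nonzero.hyps
        by (intro exI[of _ G] exI[of _ P] exI[of _ Q] exI[of _ p]) simp
    qed (simp add: nth_append)
  qed auto
  then show ?thesis using that by blast
qed

lemma no_falls_before:
  assumes "\<And>l. l < k \<Longrightarrow> \<not> degree_fall s l"
  shows "no_falls (take k s)"
  using assms by (auto simp: no_falls_def degree_fall_def)

lemma first_fall_at_first_inexact_degree:
  assumes run: "bb_run F s G P Q" and nz: "0 \<notin> set F" and fall: "first_degree_fall s k"
  defines "d \<equiv> step_degree s k"
  shows "d \<ge> 1" "\<not> exact_in_degree (set F) d" "\<And>e. e < d \<Longrightarrow> exact_in_degree (set F) e"
    "\<And>l. l \<le> k \<Longrightarrow> step_degree s l \<le> d"
proof -
  have k: "k < length s" "snd (s ! k) \<noteq> 0" "tdeg (snd (s ! k)) < d"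
    using fall by (auto simp: first_degree_fall_def degree_fall_def d_def)
  then show "d \<ge> 1" by simp
  from run k(1) obtain G' P' Q' p where st: "bb_run F (take k s) G' P' Q'" "p \<in> P'"
    "\<forall>q\<in>P'. \<not> drl_less (pair_lcm G' q) (pair_lcm G' p)"
    "\<not> pair_coprime G' p" "step_degree s k = mdeg (pair_lcm G' p)"
    "remainder (set G') (spoly (G' ! fst p) (G' ! snd p)) (snd (s ! k))"
    by (rule bb_run_at_step)
  have "no_falls (take k s)"
    using fall by (intro no_falls_before) (simp add: first_degree_fall_def)
  with st(1) nz have inv: "run_invariant F (take k s) G' P' Q'"
    by (rule bb_run_invariant)
  have d: "d = mdeg (pair_lcm G' p)" using st(5) by (simp add: d_def)
  show "\<not> exact_in_degree (set F) d"
    using not_exact_at_fall[OF inv st(2,3,6)] k d by simp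
  have "d \<le> mdeg (pair_lcm G' q)" if "q \<in> P'" for q
    using st(3) that drl.leI drl_le_mdeg d by blast
  then show "exact_in_degree (set F) e" if "e < d" for e
    using that by (intro exact_if_pairs_processed[OF inv]) (meson less_le_trans)
  show "step_degree s l \<le> d" if "l \<le> k" for l
  proof (cases "l = k")
    case False
    then have "s ! l \<in> set (take k s)"
      using that k(1) by (auto simp: in_set_conv_nth intro!: exI[of _ l])
    then show ?thesis
      using inv st(2) d by (auto simp: run_invariant_def)
  qed (simp add: d_def)
qed

lemma first_degree_fall_exists: "degree_fall s k \<Longrightarrow> \<exists>l\<le>k. first_degree_fall s l"
  using ex_least_nat_le[of "degree_fall s" k] by (auto simp: first_degree_fall_def)

section \<open>Ideals and their homogeneous components\<close>

lemma ideal_of_eq_combs: "ideal_of G = combs G UNIV"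
proof -
  interpret ideal: module "(*) :: ('v::{finite,linorder}, 'k::field) pol \<Rightarrow> _"
    by unfold_locales (rule distrib_left distrib_right mult.assoc[symmetric] mult_1_left)+
  show ?thesis
  proof safe
    fix p assume "p \<in> ideal_of G"
    then show "p \<in> combs G UNIV"
    proof (induction rule: ideal.span_induct_alt)
      case (step q g p)
      have "q * g \<in> combs G UNIV"
        by (rule combs_mult) (use step.hyps in \<open>simp add: combs_single\<close>)
      then show ?case using step.IH by (rule combs_add)
    qed (simp add: combs_zero)
  next
    fix p assume "p \<in> combs G UNIV"
    then show "p \<in> ideal_of G"
    proof induction
      case combs_zero
      show ?case by (rule ideal.span_zero)
    next
      case (combs_step p g t c)
      then show ?case
        by (intro ideal.span_add ideal.span_scale) (simp_all add: ideal.span_base)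
    qed
  qed
qed

lemma ideal_of_closed:
  fixes G :: "('v::{finite,linorder}, 'k::field) pol set"
  shows "0 \<in> ideal_of G" "p \<in> ideal_of G \<Longrightarrow> q \<in> ideal_of G \<Longrightarrow> p + q \<in> ideal_of G"
    "p \<in> ideal_of G \<Longrightarrow> - p \<in> ideal_of G" "p \<in> ideal_of G \<Longrightarrow> monom t c * p \<in> ideal_of G"
  by (simp_all add: ideal_of_eq_combs combs_zero combs_add combs_uminus combs_monom_mult)

definition component :: "nat \<Rightarrow> ('v, 'k::field) pol \<Rightarrow> ('v, 'k) pol" where
  "component d p = (\<Sum>t\<in>supp p. monom t (coeff p t when mdeg t = d))"

lemma coeff_component: "coeff (component d p) t = (coeff p t when mdeg t = d)"
  by (auto simp: component_def lookup_sum lookup_single when_def in_keys_iff)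

lemma component_homogeneous [simp]: "homogeneous d (component d p)"
  by (auto simp: homogeneous_def in_keys_iff coeff_component)

lemma component_eq_self: "homogeneous d p \<Longrightarrow> component d p = p"
  by (rule poly_mapping_eqI)
    (auto simp: coeff_component homogeneous_def in_keys_iff when_def)

lemma component_other: "homogeneous e p \<Longrightarrow> e \<noteq> d \<Longrightarrow> component d p = 0"
  by (rule poly_mapping_eqI)
    (auto simp: coeff_component homogeneous_def in_keys_iff when_def)

lemma component_add: "component d (p + q) = component d p + component d q"
  by (rule poly_mapping_eqI) (simp add: coeff_component lookup_add when_add_distrib)

lemma homogeneous_monom_mult:
  fixes p :: "('v::finite, 'k::field) pol"
  assumes "homogeneous e p" shows "homogeneous (mdeg t + e) (monom t c * p)"
  using assms supp_monom_mult[of t c p] by (auto simp: homogeneous_def mdeg_add)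

lemma homogeneous_diff:
  fixes p :: "('v, 'k::field) pol"
  shows "homogeneous d p \<Longrightarrow> homogeneous d q \<Longrightarrow> homogeneous d (p - q)"
  by (auto simp: homogeneous_def in_keys_iff lookup_minus)

definition homogeneous_gens :: "('v::linorder, 'k::zero) pol set \<Rightarrow> bool" where
  "homogeneous_gens G \<longleftrightarrow> (\<forall>g\<in>G. g \<noteq> 0 \<and> homogeneous (mdeg (LM g)) g)"

abbreviation exact_deg_combs ::
  "('v::{finite,linorder}, 'k::field) pol set \<Rightarrow> nat \<Rightarrow> ('v, 'k) pol set" where
  "exact_deg_combs G d \<equiv> combs G {m. mdeg m = d}"

text \<open>
  Over homogeneous generators each summand \<open>c t g\<close> is homogeneous, so taking a component just selects
  summands.
\<close>

lemma component_in_combs: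
  fixes G :: "('v::{finite,linorder}, 'k::field) pol set"
  assumes "homogeneous_gens G" "p \<in> combs G UNIV"
  shows "component d p \<in> exact_deg_combs G d"
  using assms(2)
proof induction
  case combs_zero
  have "component d 0 = (0 :: ('v, 'k) pol)"
    by (simp add: component_eq_self homogeneous_def)
  then show ?case by (simp add: combs.combs_zero)
next
  case (combs_step p g t c)
  have "homogeneous (mdeg (LM g)) g"
    using assms(1) combs_step.hyps by (simp add: homogeneous_gens_def)
  then have hom: "homogeneous (mdeg (t + LM g)) (monom t c * g)"
    unfolding mdeg_add by (rule homogeneous_monom_mult)
  have "component d (monom t c * g) \<in> exact_deg_combs G d"
  proof (cases "mdeg (t + LM g) = d")
    case True
    then show ?thesis
      using hom combs_step.hyps by (auto simp: component_eq_self intro: combs_single)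
  next
    case False
    then show ?thesis
      using hom by (simp add: component_other combs.combs_zero)
  qed
  then show ?case
    using combs_step.IH by (simp add: component_add combs_add)
qed

lemma homogeneous_in_ideal_iff:
  fixes G :: "('v::{finite,linorder}, 'k::field) pol set"
  assumes "homogeneous_gens G" "homogeneous d p"
  shows "p \<in> ideal_of G \<longleftrightarrow> p \<in> exact_deg_combs G d"
  using component_in_combs[OF assms(1), of p d] assms(2)
  by (auto simp: ideal_of_eq_combs component_eq_self elim: combs_mono)

section \<open>Homogenization in a fixed degree\<close>

text \<open>
  For a fixed degree \<open>d\<close>, homogenization \<open>p \<mapsto> y\<^sup>d p(x / y)\<close> is linear and identifies the
  polynomials of degree at most \<open>d\<close> with the homogeneous polynomials of degree \<open>d\<close>;
  multiplication by \<open>y\<close> becomes the inclusion of degree \<open>d\<close> in degree \<open>d + 1\<close>. The truncated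
  exponent of \<open>y\<close> makes the map total; it stays additive and injective beyond degree \<open>d\<close>, as the
  variables other than \<open>y\<close> determine the monomial.
\<close>

definition hmon :: "nat \<Rightarrow> 'x mon \<Rightarrow> 'x option mon" where
  "hmon d t = lift_mon t + Poly_Mapping.single None (d - mdeg t)"

definition homogenize_to :: "nat \<Rightarrow> ('x, 'k::field) pol \<Rightarrow> ('x option, 'k) pol" where
  "homogenize_to d p = (\<Sum>t\<in>supp p. monom (hmon d t) (coeff p t))"

lemma homogenize_eq: "homogenize f = homogenize_to (tdeg f) f"
  by (simp add: homogenize_def homogenize_to_def hmon_def)

lemma expo_lift_mon: "expo (lift_mon t) w = (case w of None \<Rightarrow> 0 | Some v \<Rightarrow> expo t v)"
  by (cases w) (auto simp: lift_mon_def lookup_sum lookup_single when_def in_keys_iff)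

lemma expo_hmon: "expo (hmon d t) w = (case w of None \<Rightarrow> d - mdeg t | Some v \<Rightarrow> expo t v)"
  by (cases w) (auto simp: hmon_def lookup_add expo_lift_mon lookup_single)

lemma mdeg_option:
  "mdeg (u :: 'x::finite option mon) = expo u None + (\<Sum>v\<in>UNIV. expo u (Some v))"
  by (simp add: mdeg_sum UNIV_option_conv sum.reindex)

lemma mdeg_hmon: "mdeg (t :: 'x::finite mon) \<le> d \<Longrightarrow> mdeg (hmon d t) = d"
  by (simp add: mdeg_option expo_hmon mdeg_sum)

lemma hmon_inject [simp]: "hmon d s = hmon d t \<longleftrightarrow> s = t"
proof
  assume eq: "hmon d s = hmon d t"
  show "s = t"
  proof (rule poly_mapping_eqI)
    fix v show "expo s v = expo t v"
      using arg_cong[OF eq, of "\<lambda>u. expo u (Some v)"] by (simp add: expo_hmon)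
  qed
qed simp

lemma hmon_surj:
  fixes u :: "'x::finite option mon"
  obtains t where "mdeg t \<le> mdeg u" "u = hmon (mdeg u) t"
proof
  define t where "t = (\<Sum>v\<in>UNIV. Poly_Mapping.single v (expo u (Some v)))"
  have t: "expo t v = expo u (Some v)" for v
    by (simp add: t_def lookup_sum lookup_single when_def)
  then have m: "mdeg u = expo u None + mdeg t"
    by (simp add: mdeg_option mdeg_sum)
  then show "mdeg t \<le> mdeg u" by simp
  show "u = hmon (mdeg u) t"
    by (rule poly_mapping_eqI) (auto simp: expo_hmon t m split: option.splits)
qed

lemma hmon_add:
  fixes s t :: "'x::finite mon"
  assumes "mdeg s \<le> a" "mdeg t \<le> b"
  shows "hmon (a + b) (s + t) = hmon a s + hmon b t"
  using assms by (intro poly_mapping_eqI)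
    (auto simp: expo_hmon lookup_add mdeg_add split: option.splits)

lemma coeff_homogenize_to: "coeff (homogenize_to d p) (hmon d t) = coeff p t"
  by (auto simp: homogenize_to_def lookup_sum lookup_single when_def in_keys_iff)

lemma homogenize_to_supset:
  "finite X \<Longrightarrow> supp p \<subseteq> X \<Longrightarrow> homogenize_to d p = (\<Sum>t\<in>X. monom (hmon d t) (coeff p t))"
  unfolding homogenize_to_def by (rule sum.mono_neutral_left) (auto simp: in_keys_iff)

lemma homogenize_to_zero [simp]: "homogenize_to d 0 = 0"
  by (simp add: homogenize_to_def)

lemma homogenize_to_add: "homogenize_to d (p + q) = homogenize_to d p + homogenize_to d q"
proof -
  let ?X = "supp p \<union> supp q"
  have "supp (p + q) \<subseteq> ?X" by (rule keys_add)
  then show ?thesis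
    by (simp add: homogenize_to_supset[of ?X] lookup_add single_add sum.distrib)
qed

lemma homogenize_to_sum:
  "homogenize_to d (\<Sum>i\<in>I. p i) = (\<Sum>i\<in>I. homogenize_to d (p i))"
  by (induction I rule: infinite_finite_induct) (simp_all add: homogenize_to_add)

lemma homogenize_to_monom: "homogenize_to d (monom t c) = monom (hmon d t) c"
  by (simp add: homogenize_to_supset[of "{t}"])

lemma homogenize_to_inject: "homogenize_to d p = homogenize_to d q \<longleftrightarrow> p = q"
proof
  assume eq: "homogenize_to d p = homogenize_to d q"
  show "p = q"
    by (rule poly_mapping_eqI) (metis eq coeff_homogenize_to)
qed simp

lemma supp_homogenize_to: "supp (homogenize_to d p) = hmon d ` supp p"
proof
  show "supp (homogenize_to d p) \<subseteq> hmon d ` supp p"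
    unfolding homogenize_to_def
    by (auto simp: in_keys_iff lookup_sum lookup_single when_def
        elim!: sum.not_neutral_contains_not_neutral split: if_splits)
  show "hmon d ` supp p \<subseteq> supp (homogenize_to d p)"
    by (auto simp: in_keys_iff coeff_homogenize_to)
qed

lemma homogeneous_homogenize_to:
  fixes p :: "('x::finite, 'k::field) pol"
  shows "(\<And>t. t \<in> supp p \<Longrightarrow> mdeg t \<le> d) \<Longrightarrow> homogeneous d (homogenize_to d p)"
  by (auto simp: homogeneous_def supp_homogenize_to mdeg_hmon)

lemma homogenize_to_surj:
  fixes h :: "('x::finite option, 'k::field) pol"
  assumes "homogeneous d h"
  obtains p where "h = homogenize_to d p" "\<And>t. t \<in> supp p \<Longrightarrow> mdeg t \<le> d"
proof -
  have "\<exists>t. mdeg t \<le> d \<and> u = hmon d t" if "u \<in> supp h" for u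
    using hmon_surj[of u] assms that unfolding homogeneous_def by metis
  then obtain \<tau> where \<tau>: "\<And>u. u \<in> supp h \<Longrightarrow> mdeg (\<tau> u) \<le> d \<and> u = hmon d (\<tau> u)"
    by metis
  let ?p = "\<Sum>u\<in>supp h. monom (\<tau> u) (coeff h u)"
  have "homogenize_to d ?p = (\<Sum>u\<in>supp h. monom u (coeff h u))"
    unfolding homogenize_to_sum homogenize_to_monom using \<tau> by (intro sum.cong) auto
  then have h: "h = homogenize_to d ?p" by (simp add: sum_monoms)
  have "mdeg t \<le> d" if t: "t \<in> supp ?p" for t
  proof -
    have "hmon d t \<in> supp h"
      using t by (subst h) (auto simp: supp_homogenize_to)
    then show ?thesis using \<tau> by fastforce
  qed
  with h that show ?thesis by blast
qed

lemma homogenize_to_monom_mult: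
  fixes p :: "('x::finite, 'k::field) pol"
  assumes "mdeg t \<le> a" "\<And>s. s \<in> supp p \<Longrightarrow> mdeg s \<le> b"
  shows "homogenize_to (a + b) (monom t c * p) = monom (hmon a t) c * homogenize_to b p"
proof -
  have "monom t c * p = (\<Sum>s\<in>supp p. monom (t + s) (c * coeff p s))"
    by (subst sum_monoms[of p, symmetric]) (simp add: sum_distrib_left mult_single)
  then have "homogenize_to (a + b) (monom t c * p) =
      (\<Sum>s\<in>supp p. monom (hmon (a + b) (t + s)) (c * coeff p s))"
    by (simp add: homogenize_to_sum homogenize_to_monom)
  also have "\<dots> = (\<Sum>s\<in>supp p. monom (hmon a t) c * monom (hmon b s) (coeff p s))"
    using assms by (intro sum.cong) (auto simp: hmon_add mult_single)
  also have "\<dots> = monom (hmon a t) c * homogenize_to b p"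
    by (simp add: homogenize_to_def sum_distrib_left)
  finally show ?thesis .
qed

lemma ymon_mult_homogenize_to:
  fixes p :: "('x::finite, 'k::field) pol"
  assumes "\<And>t. t \<in> supp p \<Longrightarrow> mdeg t \<le> d"
  shows "monom ymon 1 * homogenize_to d p = homogenize_to (Suc d) p"
proof -
  have y: "hmon (Suc 0) (0 :: 'x mon) = ymon"
    by (rule poly_mapping_eqI)
      (auto simp: expo_hmon ymon_def lookup_single when_def split: option.splits)
  have "homogenize_to (1 + d) (monom 0 1 * p) = monom (hmon 1 0) 1 * homogenize_to d p"
    using assms by (intro homogenize_to_monom_mult) auto
  then show ?thesis by (simp add: y)
qed

lemma homogenize_gen:
  fixes f :: "('x::{finite,linorder}, 'k::field) pol"
  assumes "f \<noteq> 0"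
  shows "homogenize f \<noteq> 0" "homogeneous (tdeg f) (homogenize f)"
    "mdeg (LM (homogenize f)) = tdeg f"
proof -
  show nz: "homogenize f \<noteq> 0"
    using assms homogenize_to_inject[of "tdeg f" f 0] by (simp add: homogenize_eq)
  have "mdeg t \<le> tdeg f" if "t \<in> supp f" for t
    using LM_max[OF that] drl_le_mdeg by (simp add: tdeg_eq_mdeg_LM assms)
  then show hom: "homogeneous (tdeg f) (homogenize f)"
    unfolding homogenize_eq by (rule homogeneous_homogenize_to)
  show "mdeg (LM (homogenize f)) = tdeg f"
    using hom LM_in_supp[OF nz] by (simp add: homogeneous_def)
qed

lemma homogeneous_gens_homogenize:
  fixes F :: "('x::{finite,linorder}, 'k::field) pol set"
  shows "0 \<notin> F \<Longrightarrow> homogeneous_gens (homogenize ` F)"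
  unfolding homogeneous_gens_def using homogenize_gen by (metis imageE)

lemma homogenize_to_multiple:
  fixes f :: "('x::{finite,linorder}, 'k::field) pol"
  assumes "f \<noteq> 0" "mdeg t \<le> a"
  shows "homogenize_to (a + tdeg f) (monom t c * f) = monom (hmon a t) c * homogenize f"
  unfolding homogenize_eq using assms LM_max drl_le_mdeg
  by (intro homogenize_to_monom_mult) (auto simp: tdeg_eq_mdeg_LM)

text \<open>
  The degree that a summand of a representation by \<open>F\<close> lacks is made up by a power of \<open>y\<close>;
  conversely, every homogeneous summand of degree \<open>d\<close> arises in this way.
\<close>

lemma homogenize_to_in_combs_iff:
  fixes F :: "('x::{finite,linorder}, 'k::field) pol set"
  assumes nz: "0 \<notin> F"
  shows "homogenize_to d p \<in> exact_deg_combs (homogenize ` F) d \<longleftrightarrow> p \<in> deg_combs F d"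
proof
  assume "p \<in> deg_combs F d"
  then show "homogenize_to d p \<in> exact_deg_combs (homogenize ` F) d"
  proof induction
    case (combs_step p f t c)
    have f: "f \<noteq> 0" using combs_step.hyps nz by auto
    let ?a = "d - tdeg f"
    have le: "mdeg t \<le> ?a" "?a + tdeg f = d"
      using combs_step.hyps f by (auto simp: tdeg_eq_mdeg_LM mdeg_add)
    have "monom (hmon ?a t) c * homogenize f \<in> exact_deg_combs (homogenize ` F) d"
      using combs_step.hyps f le
      by (intro combs_single) (auto simp: mdeg_add mdeg_hmon homogenize_gen)
    then have "homogenize_to d (monom t c * f) \<in> exact_deg_combs (homogenize ` F) d"
      using homogenize_to_multiple[OF f le(1), of c] le(2) by simp
    then show ?case
      using combs_step.IH by (simp add: homogenize_to_add combs_add)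
  qed (simp add: combs_zero)
next
  have "\<exists>p\<in>deg_combs F d. h = homogenize_to d p"
    if "h \<in> exact_deg_combs (homogenize ` F) d" for h
    using that
  proof induction
    case combs_zero
    then show ?case using combs.combs_zero by (intro bexI[of _ 0]) auto
  next
    case (combs_step h g u c)
    then obtain f p where f: "f \<in> F" "g = homogenize f" and p: "p \<in> deg_combs F d"
      and h: "h = homogenize_to d p" by blast
    have "f \<noteq> 0" using f nz by auto
    obtain t where t: "mdeg t \<le> mdeg u" "u = hmon (mdeg u) t" by (rule hmon_surj)
    have d: "mdeg u + tdeg f = d"
      using combs_step.hyps f \<open>f \<noteq> 0\<close> by (simp add: mdeg_add homogenize_gen)
    have "monom t c * f \<in> deg_combs F d"
      using f t d \<open>f \<noteq> 0\<close> by (intro combs_single) (auto simp: mdeg_add tdeg_eq_mdeg_LM)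
    moreover have "homogenize_to d (monom t c * f) = monom u c * g"
      using homogenize_to_multiple[OF \<open>f \<noteq> 0\<close> t(1), of c] t(2) d f(2) by simp
    ultimately show ?case
      using p h by (intro bexI[of _ "p + monom t c * f"]) (auto simp: homogenize_to_add combs_add)
  qed
  then show "p \<in> deg_combs F d" if "homogenize_to d p \<in> exact_deg_combs (homogenize ` F) d"
    using that homogenize_to_inject by metis
qed

section \<open>Injectivity of multiplication by y\<close>

lemma ideal_class_eq_iff:
  fixes G :: "('v::{finite,linorder}, 'k::field) pol set"
  shows "ideal_cong (ideal_of G) `` {f} = ideal_cong (ideal_of G) `` {g} \<longleftrightarrow> f - g \<in> ideal_of G"
proof
  assume eq: "ideal_cong (ideal_of G) `` {f} = ideal_cong (ideal_of G) `` {g}"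
  have "g \<in> ideal_cong (ideal_of G) `` {g}"
    using ideal_of_closed(1)[of G] by (simp add: ideal_cong_def)
  then show "f - g \<in> ideal_of G"
    unfolding eq[symmetric] by (simp add: ideal_cong_def)
next
  assume fg: "f - g \<in> ideal_of G"
  have "f - h \<in> ideal_of G \<longleftrightarrow> g - h \<in> ideal_of G" for h
    using ideal_of_closed(2)[of "g - h" G "f - g"] ideal_of_closed(2)[of "f - h" G "- (f - g)"]
      ideal_of_closed(3)[of "f - g" G] fg by auto
  then show "ideal_cong (ideal_of G) `` {f} = ideal_cong (ideal_of G) `` {g}"
    by (auto simp: ideal_cong_def)
qed

lemma mult_y_class:
  fixes G :: "('x::{finite,linorder} option, 'k::field) pol set"
  shows "mult_y (ideal_of G) (ideal_cong (ideal_of G) `` {f}) =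
    ideal_cong (ideal_of G) `` {monom ymon 1 * f}"
  unfolding mult_y_def
proof (rule UN_constant_eq)
  show "f \<in> ideal_cong (ideal_of G) `` {f}"
    using ideal_of_closed(1)[of G] by (simp add: ideal_cong_def)
  show "\<forall>g\<in>ideal_cong (ideal_of G) `` {f}.
      ideal_cong (ideal_of G) `` {monom ymon 1 * g} = ideal_cong (ideal_of G) `` {monom ymon 1 * f}"
  proof
    fix g assume "g \<in> ideal_cong (ideal_of G) `` {f}"
    then have "monom ymon 1 * (f - g) \<in> ideal_of G"
      by (intro ideal_of_closed(4)) (simp add: ideal_cong_def)
    then have "monom ymon 1 * f - monom ymon 1 * g \<in> ideal_of G"
      by (simp only: right_diff_distrib)
    then show "ideal_cong (ideal_of G) `` {monom ymon 1 * g} =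
        ideal_cong (ideal_of G) `` {monom ymon 1 * f}"
      using ideal_class_eq_iff by metis
  qed
qed

lemma mult_y_injective_iff_cancel:
  fixes F :: "('x::{finite,linorder}, 'k::field) pol list"
  shows "mult_y_injective F d \<longleftrightarrow> (\<forall>g. homogeneous (d - 1) g \<longrightarrow>
    monom ymon 1 * g \<in> hom_ideal F \<longrightarrow> g \<in> hom_ideal F)"
proof -
  let ?J = "hom_ideal F"
  have "mult_y_injective F d \<longleftrightarrow> (\<forall>f g. homogeneous (d - 1) f \<longrightarrow> homogeneous (d - 1) g \<longrightarrow>
      monom ymon 1 * f - monom ymon 1 * g \<in> ?J \<longrightarrow> f - g \<in> ?J)"
    unfolding mult_y_injective_def inj_on_def quot_comp_def quotient_def
    by (auto simp: mult_y_class ideal_class_eq_iff)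
  also have "\<dots> \<longleftrightarrow> (\<forall>g. homogeneous (d - 1) g \<longrightarrow> monom ymon 1 * g \<in> ?J \<longrightarrow> g \<in> ?J)"
  proof (intro iffI allI impI)
    fix g
    assume *: "\<forall>f g. homogeneous (d - 1) f \<longrightarrow> homogeneous (d - 1) g \<longrightarrow>
      monom ymon 1 * f - monom ymon 1 * g \<in> ?J \<longrightarrow> f - g \<in> ?J"
      and g: "homogeneous (d - 1) g" "monom ymon 1 * g \<in> ?J"
    have "homogeneous (d - 1) (0 :: ('x option, 'k) pol)"
      by (simp add: homogeneous_def)
    then show "g \<in> ?J"
      using *[rule_format, of g 0] g by simp
  next
    fix f g
    assume *: "\<forall>g. homogeneous (d - 1) g \<longrightarrow> monom ymon 1 * g \<in> ?J \<longrightarrow> g \<in> ?J"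
      and "homogeneous (d - 1) f" "homogeneous (d - 1) g"
      and "monom ymon 1 * f - monom ymon 1 * g \<in> ?J"
    then show "f - g \<in> ?J"
      by (auto simp flip: right_diff_distrib intro: homogeneous_diff)
  qed
  finally show ?thesis .
qed

text \<open>
  A homogeneous polynomial of degree \<open>d - 1\<close> is the homogenization of a \<open>p\<close> of degree at most
  \<open>d - 1\<close>, and its product with \<open>y\<close> is the homogenization of the same \<open>p\<close> in degree \<open>d\<close>.
  Membership in the ideal therefore only asks in which degree \<open>p\<close> can be represented by \<open>F\<close>.
\<close>

lemma mult_y_injective_iff_exact:
  fixes F :: "('x::{finite,linorder}, 'k::field) pol list"
  assumes nz: "0 \<notin> set F" and d: "d \<ge> 1"
  shows "mult_y_injective F d \<longleftrightarrow> exact_in_degree (set F) d"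
proof -
  have ideal: "homogenize_to e p \<in> hom_ideal F \<longleftrightarrow> p \<in> deg_combs (set F) e"
    if "\<And>t. t \<in> supp p \<Longrightarrow> mdeg t \<le> e" for e p
    using homogeneous_in_ideal_iff[OF homogeneous_gens_homogenize[OF nz]
        homogeneous_homogenize_to[of p e]]
      homogenize_to_in_combs_iff[OF nz, of e p] that by simp
  have y: "monom ymon 1 * homogenize_to (d - 1) p = homogenize_to d p"
    if "\<And>t. t \<in> supp p \<Longrightarrow> mdeg t \<le> d - 1" for p :: "('x, 'k) pol"
    using ymon_mult_homogenize_to[OF that] d by simp
  have "mult_y_injective F d \<longleftrightarrow> (\<forall>p. (\<forall>t\<in>supp p. mdeg t \<le> d - 1) \<longrightarrow>
      monom ymon 1 * homogenize_to (d - 1) p \<in> hom_ideal F \<longrightarrow>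
      homogenize_to (d - 1) p \<in> hom_ideal F)"
    unfolding mult_y_injective_iff_cancel
    by (metis homogenize_to_surj homogeneous_homogenize_to)
  also have "\<dots> \<longleftrightarrow> (\<forall>p. (\<forall>t\<in>supp p. mdeg t \<le> d - 1) \<longrightarrow>
      p \<in> deg_combs (set F) d \<longrightarrow> p \<in> deg_combs (set F) (d - 1))"
  proof (intro all_cong1 imp_cong refl)
    fix p :: "('x, 'k) pol" assume p: "\<forall>t\<in>supp p. mdeg t \<le> d - 1"
    then have p': "\<And>t. t \<in> supp p \<Longrightarrow> mdeg t \<le> d" by fastforce
    show "monom ymon 1 * homogenize_to (d - 1) p \<in> hom_ideal F \<longleftrightarrow> p \<in> deg_combs (set F) d"
      using y ideal[OF p'] p by simp
    show "homogenize_to (d - 1) p \<in> hom_ideal F \<longleftrightarrow> p \<in> deg_combs (set F) (d - 1)"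
      using ideal p by simp
  qed
  finally show ?thesis by (auto simp: exact_in_degree_def)
qed

section \<open>The homogeneous computation\<close>

text \<open>
  A reduction step subtracts a multiple that has the degree of the term it cancels, so the degree of
  the S-pair is kept up to the remainder. Hence a homogeneous computation has no degree falls.
\<close>

lemma homogeneous_remainder:
  fixes G :: "('v::{finite,linorder}, 'k::field) pol set"
  assumes hom: "homogeneous_gens G" and gh: "g \<in> G" "h \<in> G"
    and rem: "remainder G (spoly g h) r"
  shows "homogeneous (mdeg (mlcm (LM g) (LM h))) r"
proof -
  let ?L = "mlcm (LM g) (LM h)"
  have multiple: "homogeneous (mdeg M) (monom (M - LM f) c * f)"
    if "f \<in> G" "mdvd (LM f) M" for f M c
  proof -
    have "homogeneous (mdeg (LM f)) f"
      using hom that by (simp add: homogeneous_gens_def)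
    then have "homogeneous (mdeg (M - LM f) + mdeg (LM f)) (monom (M - LM f) c * f)"
      by (rule homogeneous_monom_mult)
    then show ?thesis
      by (simp only: mdeg_add[symmetric] mdvd_minus_add[OF that(2)])
  qed
  have "(red_step G)\<^sup>*\<^sup>* (spoly g h) r" using rem by (simp add: remainder_def)
  then show ?thesis
  proof induction
    case base
    show ?case
      unfolding spoly_eq_multiples multiple_at_def
      using gh by (intro homogeneous_diff multiple) simp_all
  next
    case (step p q)
    then obtain f t where f: "f \<in> G" "t \<in> supp p" "mdvd (LM f) t"
      and q: "q = p - monom (t - LM f) (coeff p t / LC f) * f"
      by (auto simp: red_step_def)
    have "mdeg t = mdeg ?L"
      using step.IH f(2) by (simp add: homogeneous_def)
    then show ?case
      unfolding q using step.IH multiple[OF f(1,3)] by (simp add: homogeneous_diff)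
  qed
qed

lemma homogeneous_run:
  fixes F :: "('v::{finite,linorder}, 'k::field) pol list"
  assumes "bb_run F s G P Q" "homogeneous_gens (set F)"
  shows "no_falls s \<and> homogeneous_gens (set G)"
  using assms
proof (induction rule: bb_run.induct)
  case init
  then show ?case by (simp add: no_falls_def degree_fall_def)
next
  case (select_nonzero s G P Q p r)
  then have IH: "no_falls s" "homogeneous_gens (set G)" by auto
  have "0 \<notin> set F" using select_nonzero.prems by (auto simp: homogeneous_gens_def)
  with select_nonzero.hyps(1) have "run_invariant F s G P Q"
    using IH(1) by (rule bb_run_invariant)
  then have "G ! fst p \<in> set G" "G ! snd p \<in> set G"
    using select_nonzero.hyps(2) by (auto simp: run_invariant_def)
  then have hom: "homogeneous (mdeg (pair_lcm G p)) r"
    using homogeneous_remainder IH(2) select_nonzero.hyps(5) by blast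
  then have "mdeg (LM r) = mdeg (pair_lcm G p)"
    using LM_in_supp[OF select_nonzero.hyps(6)] by (simp add: homogeneous_def)
  then show ?case
    using IH hom select_nonzero.hyps(6)
    by (auto simp: no_falls_append tdeg_eq_mdeg_LM homogeneous_gens_def)
qed (auto simp: no_falls_append)

text \<open>
  In the degree reverse lexicographic ordering with \<open>y\<close> as the smallest variable, the leading
  monomial of a homogeneous polynomial has the least exponent of \<open>y\<close> among its monomials.
\<close>

lemma divisible_by_y_if_LM:
  fixes p :: "('x::{finite,linorder} option, 'k::field) pol"
  assumes hom: "homogeneous d p" and nz: "p \<noteq> 0" and y: "mdvd ymon (LM p)"
  obtains q where "p = monom ymon 1 * q" "homogeneous (d - 1) q" "q \<noteq> 0"
    "LM p = ymon + LM q" "d \<ge> 1"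
proof -
  have dvd_iff: "mdvd ymon s \<longleftrightarrow> expo s None \<ge> 1" for s :: "'x option mon"
    by (auto simp: mdvd_def ymon_def lookup_single when_def)
  have mdeg_ymon: "mdeg (ymon :: 'x option mon) = 1"
    by (simp add: ymon_def mdeg_def)
  have div: "mdvd ymon s" if "s \<in> supp p" for s
  proof -
    have "expo (LM p) None \<le> expo s None"
    proof (cases "s = LM p")
      case False
      then have "drl_less s (LM p)" using LM_max[OF that] by (simp add: drl.less_le)
      moreover have "mdeg s = mdeg (LM p)"
        using hom that LM_in_supp[OF nz] by (simp add: homogeneous_def)
      ultimately obtain v where v: "expo (LM p) v < expo s v"
        "\<And>w. w < v \<Longrightarrow> expo s w = expo (LM p) w"
        by (auto simp: drl_less_def)
      show ?thesis
      proof (cases v)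
        case (Some x)
        then have "None < v" by simp
        then show ?thesis using v(2) by simp
      qed (use v(1) in simp)
    qed simp
    then show ?thesis using y by (simp add: dvd_iff)
  qed
  have "LM p \<in> supp p" by (rule LM_in_supp[OF nz])
  then have d: "d \<ge> 1"
    using mdeg_mono[OF y] hom mdeg_ymon by (simp add: homogeneous_def)
  define q where "q = (\<Sum>s\<in>supp p. monom (s - ymon) (coeff p s))"
  have "monom ymon 1 * q = (\<Sum>s\<in>supp p. monom s (coeff p s))"
    unfolding q_def sum_distrib_left mult_single
    using mdvd_minus_add[OF div] by (intro sum.cong) (simp_all add: add.commute)
  then have p: "p = monom ymon 1 * q" by (simp add: sum_monoms)
  have "q \<noteq> 0" using p nz by auto
  have "homogeneous (d - 1) q"
    unfolding homogeneous_def
  proof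
    fix t assume "t \<in> supp q"
    then have "ymon + t \<in> supp p"
      by (simp add: p supp_monom_mult_eq)
    then show "mdeg t = d - 1"
      using hom mdeg_ymon by (auto simp: homogeneous_def mdeg_add)
  qed
  moreover have "LM p = ymon + LM q"
    using \<open>q \<noteq> 0\<close> LM_monom_mult[of 1 q ymon] by (simp add: p)
  ultimately show ?thesis using p \<open>q \<noteq> 0\<close> d that by blast
qed

text \<open>
  If \<open>y\<close> divided the remainder, cancelling it would give an element of the ideal in degree \<open>d - 1\<close>.
  As all pairs up to that degree have been treated, its leading monomial is divisible by that of a basis
  element, and this basis element would reduce the remainder.
\<close>

lemma remainder_not_divisible_by_y:
  fixes F :: "('x::{finite,linorder}, 'k::field) pol list"
  assumes nz: "0 \<notin> set F" and run: "bb_run (map homogenize F) s G P Q" and k: "k < length s"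
    and inj: "mult_y_injective F (step_degree s k)" and r: "snd (s ! k) \<noteq> 0"
  shows "\<not> mdvd ymon (LM (snd (s ! k)))"
proof
  let ?r = "snd (s ! k)" and ?H = "set (map homogenize F)" and ?d = "step_degree s k"
  assume y: "mdvd ymon (LM ?r)"
  have homF: "homogeneous_gens ?H"
    using homogeneous_gens_homogenize[OF nz] by simp
  from run k obtain G' P' Q' p where st: "bb_run (map homogenize F) (take k s) G' P' Q'" "p \<in> P'"
    "\<forall>q\<in>P'. \<not> drl_less (pair_lcm G' q) (pair_lcm G' p)"
    "\<not> pair_coprime G' p" "?d = mdeg (pair_lcm G' p)"
    "remainder (set G') (spoly (G' ! fst p) (G' ! snd p)) ?r"
    by (rule bb_run_at_step)
  have hom: "no_falls (take k s)" "homogeneous_gens (set G')"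
    using homogeneous_run[OF st(1) homF] by auto
  have "0 \<notin> ?H" using homF by (auto simp: homogeneous_gens_def)
  with st(1) have inv: "run_invariant (map homogenize F) (take k s) G' P' Q'"
    using hom(1) by (rule bb_run_invariant)
  have "G' ! fst p \<in> set G'" "G' ! snd p \<in> set G'"
    using inv st(2) by (auto simp: run_invariant_def)
  then have "homogeneous ?d ?r"
    using homogeneous_remainder hom(2) st(5,6) by metis
  then obtain q where q: "?r = monom ymon 1 * q" "homogeneous (?d - 1) q" "q \<noteq> 0"
    "LM ?r = ymon + LM q" "?d \<ge> 1"
    using r y by (rule divisible_by_y_if_LM)
  have "?r \<in> combs ?H UNIV"
    using select_in_degree(1)[OF inv st(2,6)] by (elim combs_mono) auto
  then have "monom ymon 1 * q \<in> hom_ideal F"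
    by (simp add: ideal_of_eq_combs q(1))
  then have "q \<in> hom_ideal F"
    using inj q(2) by (simp add: mult_y_injective_iff_cancel)
  then have "q \<in> exact_deg_combs ?H (?d - 1)"
    using homogeneous_in_ideal_iff[OF homF q(2)] by simp
  then have "q \<in> deg_combs ?H (?d - 1)"
    by (elim combs_mono) auto
  moreover have "?d - 1 < mdeg (pair_lcm G' q)" if "q \<in> P'" for q
  proof -
    have "?d \<le> mdeg (pair_lcm G' q)"
      using st(3,5) that drl.leI drl_le_mdeg by metis
    then show ?thesis using q(5) by simp
  qed
  ultimately have "q \<in> combs (set G') (up_to (LM q))"
    using run_standard_representation[OF inv] q(3) by blast
  then obtain g where "g \<in> set G'" "mdvd (LM g) (LM q)"
    using LM_divisible_if_standard_representation q(3) by blast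
  then have "mdvd (LM g) (LM ?r)" "g \<in> set G'"
    unfolding q(4) using mdvd_add(1) mdvd_trans by blast+
  then show False
    using st(6) LM_in_supp[OF r] by (auto simp: remainder_def)
qed

section \<open>Minimal generators of monomial ideals\<close>

lemma monom_in_monomial_ideal_iff:
  fixes B :: "'v::{finite,linorder} mon set"
  shows "monom t (1 :: 'k::field) \<in> monomial_ideal B \<longleftrightarrow> (\<exists>b\<in>B. mdvd b t)"
proof
  let ?G = "(\<lambda>t. monom t (1 :: 'k)) ` B"
  assume "monom t (1 :: 'k) \<in> monomial_ideal B"
  then have "monom t (1 :: 'k) \<in> combs ?G UNIV"
    by (simp add: monomial_ideal_def ideal_of_eq_combs)
  then have "\<forall>s\<in>supp (monom t (1 :: 'k)). \<exists>b\<in>B. mdvd b s"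
  proof induction
    case (combs_step p g u c)
    then obtain b where b: "b \<in> B" "g = monom b 1" by auto
    have "supp (p + monom u c * g) \<subseteq> supp p \<union> {u + b}"
      using keys_add[of p "monom u c * g"] by (auto simp: b(2) mult_single split: if_splits)
    then show ?case
      using combs_step.IH b(1) mdvd_add(1) by blast
  qed simp
  then show "\<exists>b\<in>B. mdvd b t" by simp
next
  assume "\<exists>b\<in>B. mdvd b t"
  then obtain b u where b: "b \<in> B" "t = u + b" by (auto elim: mdvdE)
  have "monom u 1 * monom b (1 :: 'k) \<in> monomial_ideal B"
    unfolding monomial_ideal_def ideal_of_eq_combs using b(1) by (intro combs_single) auto
  then show "monom t (1 :: 'k) \<in> monomial_ideal B"
    by (simp add: b(2) mult_single)
qed

lemma monomial_ideal_mono: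
  fixes B :: "'v::{finite,linorder} mon set"
  assumes "\<And>b. b \<in> B \<Longrightarrow> \<exists>c\<in>C. mdvd c b"
  shows "(monomial_ideal B :: ('v, 'k::field) pol set) \<subseteq> monomial_ideal C"
proof
  fix p :: "('v, 'k) pol" assume "p \<in> monomial_ideal B"
  then have "p \<in> combs ((\<lambda>t. monom t 1) ` B) UNIV"
    by (simp add: monomial_ideal_def ideal_of_eq_combs)
  then have "p \<in> combs ((\<lambda>t. monom t 1) ` C) UNIV"
  proof (rule combs_trans)
    fix g :: "('v, 'k) pol" and t c
    assume "g \<in> (\<lambda>t. monom t 1) ` B"
    then obtain b where "b \<in> B" "g = monom b 1" by auto
    then have "g \<in> monomial_ideal C"
      using assms monom_in_monomial_ideal_iff by blast
    then show "monom t c * g \<in> combs ((\<lambda>t. monom t 1) ` C) UNIV"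
      by (auto simp: monomial_ideal_def ideal_of_eq_combs intro: combs_monom_mult)
  qed
  then show "p \<in> monomial_ideal C"
    by (simp add: monomial_ideal_def ideal_of_eq_combs)
qed

lemma mdvd_antisym: "mdvd s t \<Longrightarrow> mdvd t s \<Longrightarrow> s = t"
  by (rule poly_mapping_eqI) (simp add: mdvd_def le_antisym)

text \<open>
  A monomial lies in a monomial ideal only if a generator divides it. So a generating set contains
  every generator that is minimal with respect to divisibility, and these suffice, because degrees
  decrease along proper divisors.
\<close>

lemma min_monomial_gens_eq:
  fixes L :: "'v::{finite,linorder} mon set"
  shows "min_monomial_gens (monomial_ideal L :: ('v, 'k::field) pol set) =
    {t \<in> L. \<forall>s\<in>L. mdvd s t \<longrightarrow> s = t}"
proof -
  let ?M = "{t \<in> L. \<forall>s\<in>L. mdvd s t \<longrightarrow> s = t}"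
  let ?J = "monomial_ideal L :: ('v, 'k) pol set"
  have min: "\<exists>s\<in>?M. mdvd s t" if "t \<in> L" for t
    using that
  proof (induction t rule: measure_induct_rule[of mdeg])
    case (less t)
    show ?case
    proof (cases "t \<in> ?M")
      case False
      then obtain s where s: "s \<in> L" "mdvd s t" "s \<noteq> t" using less.prems by blast
      obtain u where u: "t = u + s" using s(2) by (rule mdvdE)
      have "u \<noteq> 0" using u s(3) by auto
      then obtain v where "expo u v \<noteq> 0" by (metis lookup_zero poly_mapping_eqI)
      then have "mdeg u > 0"
        unfolding mdeg_sum by (metis finite_class.finite_UNIV gr0I iso_tuple_UNIV_I sum_eq_0_iff)
      then have "mdeg s < mdeg t" by (simp add: u mdeg_add)
      then show ?thesis using less.IH s mdvd_trans by blast
    qed (use mdvd_refl in blast)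
  qed
  have gen: "monomial_ideal ?M = ?J"
    using min by (intro subset_antisym monomial_ideal_mono) (use mdvd_refl in blast)+
  show ?thesis
    unfolding min_monomial_gens_def
  proof (rule the_equality)
    have "monomial_ideal B \<noteq> ?J" if B: "B \<subset> ?M" for B
    proof
      obtain t where t: "t \<in> ?M" "t \<notin> B" using B by blast
      assume "monomial_ideal B = ?J"
      then have "monom t 1 \<in> (monomial_ideal B :: ('v, 'k) pol set)"
        using t(1) monom_in_monomial_ideal_iff[where 'k = 'k, of t L] mdvd_refl by blast
      then obtain b where "b \<in> B" "mdvd b t"
        using monom_in_monomial_ideal_iff by blast
      then have "b = t" using t(1) B by blast
      then show False using \<open>b \<in> B\<close> t(2) by simp
    qed
    then show "monomial_ideal ?M = ?J \<and> (\<forall>B. B \<subset> ?M \<longrightarrow> monomial_ideal B \<noteq> ?J)"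
      using gen by blast
  next
    fix B assume B: "monomial_ideal B = ?J \<and> (\<forall>B'. B' \<subset> B \<longrightarrow> monomial_ideal B' \<noteq> ?J)"
    have "t \<in> B" if t: "t \<in> ?M" for t
    proof -
      have "monom t 1 \<in> (monomial_ideal B :: ('v, 'k) pol set)"
        using t B monom_in_monomial_ideal_iff[where 'k = 'k, of t L] mdvd_refl by blast
      then obtain b where b: "b \<in> B" "mdvd b t"
        using monom_in_monomial_ideal_iff by blast
      have "monom b 1 \<in> ?J"
        using b(1) B monom_in_monomial_ideal_iff[where 'k = 'k, of b B] mdvd_refl by blast
      then obtain s where s: "s \<in> L" "mdvd s b"
        using monom_in_monomial_ideal_iff by blast
      then have "s = t" using t b(2) mdvd_trans by blast
      then show ?thesis using s b mdvd_antisym by metis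
    qed
    then show "B = ?M" using B gen by blast
  qed
qed

text \<open>
  A minimal generator \<open>t\<close> of degree \<open>d\<close> is the leading monomial of a homogeneous element of the
  ideal. If \<open>y\<close> divided \<open>t\<close>, it could be cancelled from that element, and \<open>t\<close> would not be minimal.
\<close>

lemma min_LM_gens_not_divisible_by_y:
  fixes F :: "('x::{finite,linorder}, 'k::field) pol list"
  assumes nz: "0 \<notin> set F" and inj: "mult_y_injective F d"
    and t: "t \<in> min_monomial_gens (LM_ideal (hom_ideal F))" "mdeg t = d"
  shows "\<not> mdvd ymon t"
proof
  let ?J = "hom_ideal F"
  assume y: "mdvd ymon t"
  have t_min: "t \<in> LM ` (?J - {0})" "\<And>s. s \<in> LM ` (?J - {0}) \<Longrightarrow> mdvd s t \<Longrightarrow> s = t"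
    using t(1) by (auto simp: LM_ideal_def min_monomial_gens_eq)
  then obtain g where g: "g \<in> ?J" "g \<noteq> 0" "t = LM g" by auto
  let ?p = "component d g"
  have "coeff ?p t = LC g"
    using t(2) g(3) by (simp add: coeff_component LC_def)
  then have p: "t \<in> supp ?p" "?p \<noteq> 0"
    using LC_nonzero[OF g(2)] by (auto simp: in_keys_iff)
  have "drl_le s t" if "s \<in> supp ?p" for s
    using that LM_max[of s g] g(3) by (auto simp: in_keys_iff coeff_component)
  then have LM: "LM ?p = t" using p(1) by (intro LM_eqI)
  obtain q where q: "?p = monom ymon 1 * q" "homogeneous (d - 1) q" "q \<noteq> 0"
    "LM ?p = ymon + LM q" "d \<ge> 1"
    using divisible_by_y_if_LM[OF component_homogeneous p(2)] y LM by metis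
  have "?p \<in> exact_deg_combs (homogenize ` set F) d"
    using component_in_combs[OF homogeneous_gens_homogenize[OF nz]] g(1)
    by (simp add: ideal_of_eq_combs)
  then have "?p \<in> ?J"
    unfolding ideal_of_eq_combs by (elim combs_mono) auto
  then have "q \<in> ?J"
    using inj q(1,2) by (simp add: mult_y_injective_iff_cancel)
  then have "LM q = t"
    using t_min(2)[of "LM q"] q(3,4) LM by auto
  then have "ymon = (0 :: 'x option mon)"
    using q(4) LM by simp
  then show False
    by (simp add: ymon_def flip: keys_eq_empty)
qed

lemma injectivity_condition_iff_exact:
  fixes F :: "('x::{finite,linorder}, 'k::field) pol list"
  assumes nz: "0 \<notin> set F" and run: "buchberger_computation (map homogenize F) H"
  shows "injectivity_condition F H d0 \<longleftrightarrow> (\<forall>d. 1 \<le> d \<and> d < d0 \<longrightarrow> exact_in_degree (set F) d)"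
proof
  assume "injectivity_condition F H d0"
  then show "\<forall>d. 1 \<le> d \<and> d < d0 \<longrightarrow> exact_in_degree (set F) d"
    using mult_y_injective_iff_exact[OF nz] by (simp add: injectivity_condition_def)
next
  assume "\<forall>d. 1 \<le> d \<and> d < d0 \<longrightarrow> exact_in_degree (set F) d"
  then have inj: "mult_y_injective F d" if "1 \<le> d \<and> d < d0" for d
    using that mult_y_injective_iff_exact[OF nz] by simp
  obtain G Q where "bb_run (map homogenize F) H G {} Q"
    using run by (auto simp: buchberger_computation_def)
  then show "injectivity_condition F H d0"
    unfolding injectivity_condition_def
    using inj min_LM_gens_not_divisible_by_y[OF nz] remainder_not_divisible_by_y[OF nz] by blast
qed

section \<open>The first degree fall and the failure of injectivity\<close>

lemma d_inj_eq:
  fixes F :: "('x::{finite,linorder}, 'k::field) pol list"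
  assumes "0 \<notin> set F"
  shows "d_inj F = Inf {enat d | d. d \<ge> 1 \<and> \<not> exact_in_degree (set F) d}"
  unfolding d_inj_def using mult_y_injective_iff_exact[OF assms] by metis

theorem corollary4p2p6:
  fixes F :: "('x::{finite, linorder}, 'k::field) pol list"
    and A :: "(nat \<times> ('x, 'k) pol) list"
  assumes "0 \<notin> set F"
    and "buchberger_computation F A"
  shows "(d_inj F < \<infinity> \<longrightarrow> (\<exists>k. first_degree_fall A k \<and> enat (step_degree A k) = d_inj F)) \<and>
    (d_inj F = \<infinity> \<longrightarrow> (\<forall>k. \<not> degree_fall A k)) \<and>
    (\<forall>H d0. buchberger_computation (map homogenize F) H \<and> d0 \<ge> 1 \<longrightarrow>
       (injectivity_condition F H d0 \<longleftrightarrow> \<not> degree_fall_below A d0))"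
proof -
  obtain G Q where run: "bb_run F A G {} Q"
    using assms(2) by (auto simp: buchberger_computation_def)
  show ?thesis
  proof (cases "\<exists>k. degree_fall A k")
    case False
    then have "no_falls A" by (simp add: no_falls_def)
    with run assms(1) have "run_invariant F A G {} Q" by (rule bb_run_invariant)
    then have exact: "exact_in_degree (set F) d" for d
      by (rule exact_if_pairs_processed) simp
    then have "d_inj F = \<infinity>"
      by (simp add: d_inj_eq[OF assms(1)] top_enat_def)
    moreover have "\<not> degree_fall_below A d0" for d0
      using False by (simp add: degree_fall_below_def)
    ultimately show ?thesis
      using False exact injectivity_condition_iff_exact[OF assms(1)] by simp
  next
    case True
    then obtain k where k: "first_degree_fall A k"
      using first_degree_fall_exists by blast
    let ?d = "step_degree A k"
    note first = first_fall_at_first_inexact_degree[OF run assms(1) k]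
    have "d_inj F = enat ?d"
      unfolding d_inj_eq[OF assms(1)]
    proof (rule Inf_eqI)
      show "enat ?d \<le> i" if "i \<in> {enat d |d. 1 \<le> d \<and> \<not> exact_in_degree (set F) d}" for i
        using that first(3) by (auto simp: not_less[symmetric])
      show "i \<le> enat ?d"
        if "\<And>j. j \<in> {enat d |d. 1 \<le> d \<and> \<not> exact_in_degree (set F) d} \<Longrightarrow> i \<le> j" for i
        using that first(1,2) by blast
    qed
    moreover have "degree_fall_below A d0 \<longleftrightarrow> ?d < d0" for d0
    proof
      assume "degree_fall_below A d0"
      then obtain l where l: "degree_fall A l" "\<forall>i\<le>l. step_degree A i < d0"
        by (auto simp: degree_fall_below_def)
      then have "k \<le> l" using k by (meson first_degree_fall_def not_le)
      then show "?d < d0" using l(2) by blast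
    next
      assume "?d < d0"
      then show "degree_fall_below A d0"
        using k first(4) unfolding degree_fall_below_def first_degree_fall_def
        by (meson le_less_trans)
    qed
    moreover have "(\<forall>d. 1 \<le> d \<and> d < d0 \<longrightarrow> exact_in_degree (set F) d) \<longleftrightarrow> \<not> ?d < d0" for d0
      using first(1-3) by (meson less_le_trans not_less)
    ultimately show ?thesis
      using k injectivity_condition_iff_exact[OF assms(1)] by auto
  qed
qed

end
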